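(* Let $L$ be a division ring with $\mathbb{C} \subseteq L \subseteq \mathbb{C}(T, \sigma)$ such that $\phi(L)$ is $\sigma$-invariant. Then there is $v \in \mathbb{C}(T, \sigma)$ such that $L = \mathbb{C}(v)$.
   Context: Let $\sigma$ be complex conjugation on $\mathbb{C}$. $\mathbb{C}[T,\sigma]$ is the skew polynomial ring of polynomials $\sum a_\ell T^\ell$ ($a_\ell\in\mathbb{C}$) with multiplication determined by $Ta=\sigma(a)T$; it is a right Ore domain and $\mathbb{C}(T,\sigma)$ is its division ring of right fractions $PQ^{-1}$. Let $\mathbb{H}=\mathbb{R}\oplus\mathbb{R}i\oplus\mathbb{R}j\oplus\mathbb{R}k$ be Hamilton's quaternions ($i^2=j^2=k^2=ijk=-1$), with $\mathbb{C}=\mathbb{R}\oplus\mathbb{R}i$; $\mathbb{H}[X]$ is the polynomial ring in a central variable $X$ and $\mathbb{H}(X)$ its division ring of right fractions. The map $\phi:\mathbb{C}[T,\sigma]\to\mathbb{H}[X]$, $\sum a_\ell T^\ell\mapsto\sum a_\ell j^\ell X^\ell$, is an injective ring homomorphism, and it extends to an injective ring homomorphism $\phi:\mathbb{C}(T,\sigma)\to\mathbb{H}(X)$, $PQ^{-1}\mapsto\phi(P)\phi(Q)^{-1}$. Extend $\sigma$ to the automorphism of $\mathbb{H}$ given by $a+bi+cj+dk\mapsto a-bi+cj-dk$ ($a,b,c,d\in\mathbb{R}$), then to $\mathbb{H}[X]$ coefficientwise ($\sigma(\sum a_\ell X^\ell)=\sum\sigma(a_\ell)X^\ell$), then to $\mathbb{H}(X)$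 by $\sigma(PQ^{-1})=\sigma(P)\sigma(Q)^{-1}$. A subset $S\subseteq\mathbb{H}(X)$ is $\sigma$-invariant if $\sigma(S)=S$. For $v\in\mathbb{C}(T,\sigma)$, $\mathbb{C}(v)$ denotes the smallest division subring of $\mathbb{C}(T,\sigma)$ containing $\mathbb{C}$ and $v$. *)

theory Defs
  imports "HOL-Computational_Algebra.Polynomial"
begin

section \<open>Skew polynomials over a division ring with an automorphism\<close>

class twisted_division_ring = division_ring +
  fixes twist :: "'a \<Rightarrow> 'a"
  assumes twist_add: "twist (a + b) = twist a + twist b"
    and twist_mult: "twist (a * b) = twist a * twist b"
    and bij_twist: "bij twist"

lemma twist_0 [simp]: "twist (0::'a::twisted_division_ring) = 0"
  using twist_add[of "0::'a" 0] by simp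

lemma twist_eq_0_iff [simp]: "twist (a::'a::twisted_division_ring) = 0 \<longleftrightarrow> a = 0"
  by (metis bij_twist bij_is_inj injD twist_0)

lemma twist_1 [simp]: "twist (1::'a::twisted_division_ring) = 1"
  by (metis mult_cancel_right2 twist_eq_0_iff twist_mult mult_1_left zero_neq_one)

lemma twist_pow_0 [simp]: "(twist ^^ n) (0::'a::twisted_division_ring) = 0"
  by (induction n) auto

lemma twist_pow_1 [simp]: "(twist ^^ n) (1::'a::twisted_division_ring) = 1"
  by (induction n) auto

lemma twist_pow_eq_0_iff [simp]: "(twist ^^ n) (a::'a::twisted_division_ring) = 0 \<longleftrightarrow> a = 0"
  by (induction n) auto

lemma twist_pow_add: "(twist ^^ n) (a + b::'a::twisted_division_ring) = (twist ^^ n) a + (twist ^^ n) b"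
  by (induction n) (auto simp: twist_add)

lemma twist_pow_mult: "(twist ^^ n) (a * b::'a::twisted_division_ring) = (twist ^^ n) a * (twist ^^ n) b"
  by (induction n) (auto simp: twist_mult)

lemma twist_pow_sum:
  "(twist ^^ n) (sum f A :: 'a::twisted_division_ring) = (\<Sum>x\<in>A. (twist ^^ n) (f x))"
  by (induction A rule: infinite_finite_induct) (auto simp: twist_pow_add)

lemma surj_twist_pow: "surj ((twist :: 'a::twisted_division_ring \<Rightarrow> 'a) ^^ n)"
  by (rule bij_is_surj) (rule bij_fn[OF bij_twist])

text \<open>Finitely supported coefficient sequences; a sequence \<open>a\<close> stands for the sum of
  \<open>a\<^sub>\<ell> T\<^sup>\<ell>\<close>, with the coefficients to the left of the powers of \<open>T\<close>.  The additive structure is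
  that of \<^typ>\<open>'a poly\<close>; the multiplication is determined by \<open>T a = twist a T\<close>.\<close>

typedef (overloaded) 'a skew_poly = "UNIV :: 'a::zero poly set"
  morphisms poly_of_skew Skew ..

setup_lifting type_definition_skew_poly

lift_definition scoeff :: "'a::zero skew_poly \<Rightarrow> nat \<Rightarrow> 'a" is coeff .

lift_definition sdegree :: "'a::zero skew_poly \<Rightarrow> nat" is degree .

lift_definition smonom :: "'a::zero \<Rightarrow> nat \<Rightarrow> 'a skew_poly" is monom .

lift_definition map_skew :: "(nat \<Rightarrow> 'a \<Rightarrow> 'b) \<Rightarrow> 'a::zero skew_poly \<Rightarrow> 'b::comm_monoid_add skew_poly"
  is "\<lambda>f p. \<Sum>l\<le>degree p. monom (f l (coeff p l)) l" .

lemma skew_poly_eq_iff: "p = q \<longleftrightarrow> (\<forall>n. scoeff p n = scoeff q n)"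
  by transfer (auto simp: poly_eq_iff)

lemma scoeff_smonom [simp]: "scoeff (smonom a m) n = (if m = n then a else 0)"
  by transfer simp

lemma scoeff_map_skew:
  assumes "\<And>l. f l 0 = 0"
  shows "scoeff (map_skew f p) n = f n (scoeff p n)"
  using assms by transfer (auto simp: coeff_sum coeff_eq_0)

lemma sdegree_le: "(\<And>i. i > n \<Longrightarrow> scoeff p i = 0) \<Longrightarrow> sdegree p \<le> n"
  by transfer (auto intro: degree_le)

lemma scoeff_eq_0: "n > sdegree p \<Longrightarrow> scoeff p n = 0"
  by transfer (auto intro: coeff_eq_0)

instantiation skew_poly :: (ab_group_add) ab_group_add
begin

lift_definition zero_skew_poly :: "'a skew_poly" is 0 .
lift_definition plus_skew_poly :: "'a skew_poly \<Rightarrow> 'a skew_poly \<Rightarrow> 'a skew_poly" is plus .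
lift_definition minus_skew_poly :: "'a skew_poly \<Rightarrow> 'a skew_poly \<Rightarrow> 'a skew_poly" is minus .
lift_definition uminus_skew_poly :: "'a skew_poly \<Rightarrow> 'a skew_poly" is uminus .

instance by standard (transfer; simp)+

end

lemma scoeff_0 [simp]: "scoeff 0 n = 0"
  by transfer simp

lemma scoeff_add [simp]: "scoeff (p + q) n = scoeff p n + scoeff q n"
  by transfer simp

lemma scoeff_diff [simp]: "scoeff (p - q) n = scoeff p n - scoeff q n"
  by transfer simp

lemma scoeff_uminus [simp]: "scoeff (- p) n = - scoeff p n"
  by transfer simp

lemma lead_scoeff_eq_0_iff [simp]: "scoeff p (sdegree p) = 0 \<longleftrightarrow> p = 0"
  by transfer simp

instantiation skew_poly :: (twisted_division_ring) "{one, times}"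
begin

definition one_skew_poly :: "'a skew_poly" where
  "1 = smonom 1 0"

lift_definition times_skew_poly :: "'a skew_poly \<Rightarrow> 'a skew_poly \<Rightarrow> 'a skew_poly" is
  "\<lambda>p q. Abs_poly (\<lambda>n. \<Sum>i\<le>n. coeff p i * (twist ^^ i) (coeff q (n - i)))" .

instance ..

end

lemma scoeff_1: "scoeff 1 n = (if n = 0 then 1 else 0)"
  by (simp add: one_skew_poly_def)

lemma scoeff_mult:
  fixes p q :: "'a::twisted_division_ring skew_poly"
  shows "scoeff (p * q) n = (\<Sum>i\<le>n. scoeff p i * (twist ^^ i) (scoeff q (n - i)))"
proof (transfer fixing: n)
  fix p q :: "'a poly"
  let ?f = "\<lambda>n. \<Sum>i\<le>n. coeff p i * (twist ^^ i) (coeff q (n - i))"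
  have "?f n = 0" if "n > degree p + degree q" for n
  proof (rule sum.neutral, clarify)
    fix i
    from that have "i > degree p \<or> n - i > degree q" by linarith
    then show "coeff p i * (twist ^^ i) (coeff q (n - i)) = 0"
      by (auto simp: coeff_eq_0)
  qed
  then have "\<forall>\<^sub>\<infinity> n. ?f n = 0"
    unfolding MOST_nat by blast
  then show "coeff (Abs_poly ?f) n = ?f n"
    by (simp add: Abs_poly_inverse)
qed

instance skew_poly :: (twisted_division_ring) ring_1
proof
  fix a b c :: "'a skew_poly"
  show "a * b * c = a * (b * c)"
    unfolding skew_poly_eq_iff
  proof
    fix n
    have "(\<Sum>j=0..n. \<Sum>i=0..j. scoeff a i * (twist ^^ i) (scoeff b (j - i)) * (twist ^^ (i + (j - i))) (scoeff c (n - j))) =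
        (\<Sum>j=0..n. \<Sum>i=0..n - j. scoeff a j * (twist ^^ j) (scoeff b i) * (twist ^^ (j + i)) (scoeff c (n - j - i)))"
    proof -
      have *: "(\<Sum>j=0..k. \<Sum>i=0..j. f i (j - i) (n - j)) =
         (\<Sum>j=0..k. \<Sum>i=0..k - j. f j i (n - j - i))" for k and f :: "nat \<Rightarrow> nat \<Rightarrow> nat \<Rightarrow> 'a"
        by (induct k) (simp_all add: Suc_diff_le sum.distrib add.assoc)
      show ?thesis
        by (rule *[where f = "\<lambda>i k m. scoeff a i * (twist ^^ i) (scoeff b k) * (twist ^^ (i + k)) (scoeff c m)"])
    qed
    moreover have "scoeff (a * b * c) n =
        (\<Sum>j=0..n. \<Sum>i=0..j. scoeff a i * (twist ^^ i) (scoeff b (j - i)) * (twist ^^ (i + (j - i))) (scoeff c (n - j)))"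
      by (simp add: scoeff_mult atMost_atLeast0 sum_distrib_right)
    moreover have "scoeff (a * (b * c)) n =
        (\<Sum>j=0..n. \<Sum>i=0..n - j. scoeff a j * (twist ^^ j) (scoeff b i) * (twist ^^ (j + i)) (scoeff c (n - j - i)))"
      by (simp add: scoeff_mult atMost_atLeast0 twist_pow_sum twist_pow_mult sum_distrib_left
          mult.assoc funpow_add)
    ultimately show "scoeff (a * b * c) n = scoeff (a * (b * c)) n" by simp
  qed
  show "1 * a = a"
    unfolding skew_poly_eq_iff
  proof
    fix n
    have "scoeff (1 * a) n = (\<Sum>i\<le>n. if i = 0 then scoeff a n else 0)"
      unfolding scoeff_mult by (rule sum.cong) (auto simp: scoeff_1)
    then show "scoeff (1 * a) n = scoeff a n" by simp
  qed
  show "a * 1 = a"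
    unfolding skew_poly_eq_iff
  proof
    fix n
    have "scoeff (a * 1) n = (\<Sum>i\<le>n. if i = n then scoeff a n else 0)"
      unfolding scoeff_mult by (rule sum.cong) (auto simp: scoeff_1)
    then show "scoeff (a * 1) n = scoeff a n" by simp
  qed
  show "(a + b) * c = a * c + b * c"
    by (simp add: skew_poly_eq_iff scoeff_mult distrib_right sum.distrib)
  show "a * (b + c) = a * b + a * c"
    by (simp add: skew_poly_eq_iff scoeff_mult distrib_left sum.distrib twist_pow_add)
  show "(0::'a skew_poly) \<noteq> 1"
    by (auto simp: skew_poly_eq_iff scoeff_1)
qed

lemma smonom_mult_smonom:
  fixes a b :: "'a::twisted_division_ring"
  shows "smonom a m * smonom b n = smonom (a * (twist ^^ m) b) (m + n)"
  unfolding skew_poly_eq_iff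
proof
  fix k
  have "scoeff (smonom a m * smonom b n) k = (\<Sum>i\<le>k. if i = m then (if k = m + n then a * (twist ^^ m) b else 0) else 0)"
    unfolding scoeff_mult by (rule sum.cong) auto
  then show "scoeff (smonom a m * smonom b n) k = scoeff (smonom (a * (twist ^^ m) b) (m + n)) k"
    by auto
qed

lemma skew_commutation:
  "smonom 1 1 * smonom a 0 = smonom (twist a) 0 * smonom (1::'a::twisted_division_ring) 1"
  by (simp add: smonom_mult_smonom)

lemma scoeff_mult_degree_sum:
  fixes p q :: "'a::twisted_division_ring skew_poly"
  shows "scoeff (p * q) (sdegree p + sdegree q) =
    scoeff p (sdegree p) * (twist ^^ sdegree p) (scoeff q (sdegree q))"
proof -
  have "scoeff (p * q) (sdegree p + sdegree q) =
     (\<Sum>i\<le>sdegree p + sdegree q. if i = sdegree p then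
        scoeff p (sdegree p) * (twist ^^ sdegree p) (scoeff q (sdegree q)) else 0)"
    unfolding scoeff_mult
  proof (rule sum.cong)
    fix i assume "i \<in> {..sdegree p + sdegree q}"
    have "i > sdegree p \<or> i = sdegree p \<or> sdegree p + sdegree q - i > sdegree q"
      by linarith
    then show "scoeff p i * (twist ^^ i) (scoeff q (sdegree p + sdegree q - i)) =
       (if i = sdegree p then
        scoeff p (sdegree p) * (twist ^^ sdegree p) (scoeff q (sdegree q)) else 0)"
      by (auto simp: scoeff_eq_0)
  qed simp
  then show ?thesis by simp
qed

lemma sdegree_mult_le:
  fixes p q :: "'a::twisted_division_ring skew_poly"
  shows "sdegree (p * q) \<le> sdegree p + sdegree q"
proof (rule sdegree_le)
  fix n assume n: "n > sdegree p + sdegree q"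
  show "scoeff (p * q) n = 0"
    unfolding scoeff_mult
  proof (rule sum.neutral, clarify)
    fix i
    from n have "i > sdegree p \<or> n - i > sdegree q" by linarith
    then show "scoeff p i * (twist ^^ i) (scoeff q (n - i)) = 0"
      by (auto simp: scoeff_eq_0)
  qed
qed

instance skew_poly :: (twisted_division_ring) ring_1_no_zero_divisors
proof
  fix p q :: "'a skew_poly"
  assume "p \<noteq> 0" "q \<noteq> 0"
  then have "scoeff (p * q) (sdegree p + sdegree q) \<noteq> 0"
    by (simp add: scoeff_mult_degree_sum)
  then show "p * q \<noteq> 0" by auto
qed

lemma skew_poly_division:
  fixes a b :: "'a::twisted_division_ring skew_poly"
  assumes "b \<noteq> 0"
  shows "\<exists>q r. a = b * q + r \<and> (r = 0 \<or> sdegree r < sdegree b)"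
proof (induction "if a = 0 then 0 else Suc (sdegree a)" arbitrary: a rule: less_induct)
  case less
  show ?case
  proof (cases "a = 0 \<or> sdegree a < sdegree b")
    case True
    then show ?thesis by (intro exI[of _ 0] exI[of _ a]) auto
  next
    case False
    define m where "m = sdegree b"
    define n where "n = sdegree a - sdegree b"
    have mn: "sdegree a = m + n" using False by (simp add: m_def n_def)
    obtain c where c: "(twist ^^ m) c = inverse (scoeff b m) * scoeff a (m + n)"
      using surj_twist_pow[of m] by (metis surjD)
    have bm: "scoeff b m \<noteq> 0" using assms by (simp add: m_def)
    have an: "scoeff a (m + n) \<noteq> 0" using False by (simp flip: mn)
    have c0: "c \<noteq> 0" using c bm an by (metis mult_eq_0_iff nonzero_imp_inverse_nonzero twist_pow_0)
    define t where "t = smonom c n"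
    have deg_t: "sdegree t = n"
      unfolding t_def using c0 by transfer (simp add: degree_monom_eq)
    define a' where "a' = a - b * t"
    have "scoeff (b * t) (m + n) = scoeff b m * (twist ^^ m) c"
      using scoeff_mult_degree_sum[of b t] unfolding deg_t by (simp add: t_def flip: m_def)
    also have "\<dots> = scoeff a (m + n)"
      using bm by (simp add: c flip: mult.assoc)
    finally have top: "scoeff a' (m + n) = 0" by (simp add: a'_def)
    have high: "scoeff a' i = 0" if "i > m + n" for i
      using that sdegree_mult_le[of b t]
      by (simp add: a'_def scoeff_eq_0 mn deg_t flip: m_def)
    have "sdegree a' \<le> m + n"
      by (rule sdegree_le) (rule high)
    then have "a' = 0 \<or> sdegree a' < sdegree a"
      using top mn by (metis le_neq_implies_less lead_scoeff_eq_0_iff)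
    then have "(if a' = 0 then 0 else Suc (sdegree a')) < (if a = 0 then 0 else Suc (sdegree a))"
      using False by auto
    from less[OF this] obtain q r where "a' = b * q + r" "r = 0 \<or> sdegree r < sdegree b" by blast
    then show ?thesis
      by (intro exI[of _ "q + t"] exI[of _ r]) (auto simp: a'_def algebra_simps)
  qed
qed

section \<open>The division ring of right fractions of a right Ore domain\<close>

text \<open>For \<open>a \<noteq> 0\<close> the axiom says that \<open>a\<close> and \<open>b\<close> have a nonzero common right multiple;
  for \<open>a = 0\<close> it holds trivially.\<close>

class right_ore_domain = ring_1_no_zero_divisors +
  assumes right_ore: "b \<noteq> 0 \<Longrightarrow> \<exists>x y. x \<noteq> 0 \<and> a * x = b * y"

instance skew_poly :: (twisted_division_ring) right_ore_domain
proof
  fix a b :: "'a skew_poly"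
  assume "b \<noteq> 0"
  then show "\<exists>x y. x \<noteq> 0 \<and> a * x = b * y"
  proof (induction "sdegree b" arbitrary: a b rule: less_induct)
    case less
    obtain q r where qr: "a = b * q + r" "r = 0 \<or> sdegree r < sdegree b"
      using skew_poly_division less.prems by blast
    show ?case
    proof (cases "r = 0")
      case True
      then show ?thesis using qr by (intro exI[of _ 1] exI[of _ q]) auto
    next
      case False
      then obtain x y where xy: "x \<noteq> 0" "b * x = r * y"
        using less.hyps[of r b] qr by auto
      then have "y \<noteq> 0" using less.prems by (metis mult_eq_0_iff)
      moreover have "a * y = b * (q * y + x)"
        by (simp add: qr xy algebra_simps)
      ultimately show ?thesis by blast
    qed
  qed
qed

text \<open>A pair \<open>(p, q)\<close> represents the right fraction \<open>p q\<^sup>-\<^sup>1\<close>.\<close>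

definition rfractrel :: "'a::right_ore_domain \<times> 'a \<Rightarrow> 'a \<times> 'a \<Rightarrow> bool" where
  "rfractrel = (\<lambda>x y. snd x \<noteq> 0 \<and> snd y \<noteq> 0 \<and>
     (\<exists>u v. u \<noteq> 0 \<and> v \<noteq> 0 \<and> snd x * u = snd y * v \<and> fst x * u = fst y * v))"

lemma part_equivp_rfractrel: "part_equivp rfractrel"
proof (rule part_equivpI)
  show "\<exists>x. rfractrel x (x :: 'a \<times> 'a)"
    by (rule exI[of _ "(0, 1)"]) (auto simp: rfractrel_def intro: exI[of _ 1])
  show "symp (rfractrel :: 'a \<times> 'a \<Rightarrow> _)"
    unfolding symp_def rfractrel_def by metis
  show "transp (rfractrel :: 'a \<times> 'a \<Rightarrow> _)"
  proof (rule transpI, unfold split_paired_all)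
    fix a b c d e f :: 'a
    assume 1: "rfractrel (a, b) (c, d)" and 2: "rfractrel (c, d) (e, f)"
    from 1 obtain u v where uv: "u \<noteq> 0" "v \<noteq> 0" "b * u = d * v" "a * u = c * v"
      by (auto simp: rfractrel_def)
    from 2 obtain w z where wz: "w \<noteq> 0" "z \<noteq> 0" "d * w = f * z" "c * w = e * z"
      by (auto simp: rfractrel_def)
    obtain x y where xy: "x \<noteq> 0" "v * x = w * y"
      using right_ore[OF wz(1), of v] by blast
    have "y \<noteq> 0" using xy uv(2) by (metis mult_eq_0_iff)
    moreover have "b * (u * x) = f * (z * y)"
      by (metis mult.assoc uv(3) wz(3) xy(2))
    moreover have "a * (u * x) = e * (z * y)"
      by (metis mult.assoc uv(4) wz(4) xy(2))
    ultimately show "rfractrel (a, b) (e, f)"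
      using 1 2 mult_eq_0_iff[of u x] mult_eq_0_iff[of z y] xy(1) uv(1) wz(2)
      unfolding rfractrel_def fst_conv snd_conv by blast
  qed
qed

quotient_type (overloaded) 'a rfract = "'a::right_ore_domain \<times> 'a" / partial: rfractrel
  by (rule part_equivp_rfractrel)

lift_definition RFract :: "'a::right_ore_domain \<Rightarrow> 'a \<Rightarrow> 'a rfract"
  is "\<lambda>a b. if b = 0 then (0, 1) else (a, b)"
  by (auto simp: rfractrel_def intro: exI[of _ 1])

lemma RFract_cases:
  obtains a b where "q = RFract a b" "b \<noteq> 0"
  by transfer (auto simp: rfractrel_def)

lemma RFract_eq_iff:
  assumes "b \<noteq> 0" "d \<noteq> 0"
  shows "RFract a b = RFract c d \<longleftrightarrow> (\<exists>u v. u \<noteq> 0 \<and> v \<noteq> 0 \<and> b * u = d * v \<and> a * u = c * v)"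
  using assms by transfer (simp add: rfractrel_def)

text \<open>One pair of multipliers producing a common denominator decides equality.\<close>

lemma RFract_eq_iff_common:
  assumes "b \<noteq> 0" "d \<noteq> 0" "u \<noteq> 0" "v \<noteq> 0" and bd: "b * u = d * v"
  shows "RFract a b = RFract c d \<longleftrightarrow> a * u = c * v"
proof
  assume "RFract a b = RFract c d"
  then obtain u' v' where *: "u' \<noteq> 0" "b * u' = d * v'" "a * u' = c * v'"
    using assms RFract_eq_iff by metis
  obtain x y where xy: "x \<noteq> 0" "u * x = u' * y"
    using right_ore[OF *(1), of u] by blast
  have "d * (v * x) = d * (v' * y)"
    by (metis * bd mult.assoc xy(2))
  then have "v * x = v' * y" using assms by simp
  then have "(a * u) * x = (c * v) * x"
    by (metis * mult.assoc xy(2))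
  then show "a * u = c * v" using xy by simp
qed (use assms RFract_eq_iff in blast)

lemma RFract_expand: "u \<noteq> 0 \<Longrightarrow> b \<noteq> 0 \<Longrightarrow> RFract (a * u) (b * u) = RFract a b"
  by (subst RFract_eq_iff_common[of _ _ 1 u]) auto

lemma RFract_common_denominator:
  obtains a c b where "x = RFract a b" "y = RFract c b" "b \<noteq> 0"
proof -
  obtain a b where x: "x = RFract a b" "b \<noteq> 0" by (rule RFract_cases)
  obtain c d where y: "y = RFract c d" "d \<noteq> 0" by (rule RFract_cases)
  obtain u v where uv: "u \<noteq> 0" "b * u = d * v" using right_ore y by blast
  then have v: "v \<noteq> 0" using x by (metis mult_eq_0_iff)
  have "x = RFract (a * u) (b * u)"
    by (simp only: x RFract_expand[OF uv(1) x(2)])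
  moreover have "y = RFract (c * v) (b * u)"
    by (simp only: y uv RFract_expand[OF v y(2)])
  moreover have "b * u \<noteq> 0" using x(2) uv(1) by simp
  ultimately show ?thesis using that by blast
qed

lemma RFract_common_middle:
  assumes "b \<noteq> 0"
  obtains c d where "y = RFract (b * c) d" "d \<noteq> 0"
proof -
  obtain e d where y: "y = RFract e d" "d \<noteq> 0" by (rule RFract_cases)
  obtain u v where uv: "u \<noteq> 0" "e * u = b * v" using right_ore assms by blast
  have "y = RFract (b * v) (d * u)"
    unfolding uv(2)[symmetric] y(1) by (simp only: RFract_expand[OF uv(1) y(2)])
  moreover have "d * u \<noteq> 0" using y uv by simp
  ultimately show ?thesis using that by blast
qed

instantiation rfract :: (right_ore_domain) "{zero, one, plus, minus, uminus, times, inverse}"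
begin

definition zero_rfract :: "'a rfract" where "0 = RFract 0 1"

definition one_rfract :: "'a rfract" where "1 = RFract 1 1"

text \<open>\<open>a b\<^sup>-\<^sup>1 + c b\<^sup>-\<^sup>1 = (a + c) b\<^sup>-\<^sup>1\<close>, \<open>(a b\<^sup>-\<^sup>1) ((b c) d\<^sup>-\<^sup>1) = (a c) d\<^sup>-\<^sup>1\<close> and
  \<open>(a b\<^sup>-\<^sup>1)\<^sup>-\<^sup>1 = b a\<^sup>-\<^sup>1\<close>; the Ore condition brings every pair of fractions into the required
  form, and the results do not depend on the representation (lemmas \<open>add_RFract\<close>,
  \<open>mult_RFract\<close>, \<open>inverse_RFract\<close> below).\<close>

definition plus_rfract :: "'a rfract \<Rightarrow> 'a rfract \<Rightarrow> 'a rfract" where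
  "x + y = (THE z. \<exists>a b c. b \<noteq> 0 \<and> x = RFract a b \<and> y = RFract c b \<and> z = RFract (a + c) b)"

definition times_rfract :: "'a rfract \<Rightarrow> 'a rfract \<Rightarrow> 'a rfract" where
  "x * y = (THE z. \<exists>a b c d. b \<noteq> 0 \<and> d \<noteq> 0 \<and>
     x = RFract a b \<and> y = RFract (b * c) d \<and> z = RFract (a * c) d)"

definition uminus_rfract :: "'a rfract \<Rightarrow> 'a rfract" where
  "- x = (THE z. \<exists>a b. b \<noteq> 0 \<and> x = RFract a b \<and> z = RFract (- a) b)"

definition minus_rfract :: "'a rfract \<Rightarrow> 'a rfract \<Rightarrow> 'a rfract" where
  "x - y = x + - (y :: 'a rfract)"

definition inverse_rfract :: "'a rfract \<Rightarrow> 'a rfract" where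
  "inverse x = (if x = 0 then 0 else
     (THE z. \<exists>a b. a \<noteq> 0 \<and> b \<noteq> 0 \<and> x = RFract a b \<and> z = RFract b a))"

definition divide_rfract :: "'a rfract \<Rightarrow> 'a rfract \<Rightarrow> 'a rfract" where
  "x div y = x * inverse (y :: 'a rfract)"

instance ..

end

lemma common_multiple:
  fixes b d :: "'a::right_ore_domain"
  assumes "b \<noteq> 0" "d \<noteq> 0"
  obtains u v where "u \<noteq> 0" "v \<noteq> 0" "b * u = d * v"
  using right_ore[OF assms(2), of b] assms by (metis mult_eq_0_iff)

lemma add_RFract:
  assumes "b \<noteq> 0"
  shows "RFract a b + RFract c b = RFract (a + c) b"
  unfolding plus_rfract_def
proof (rule the_equality)
  fix z
  assume "\<exists>a' b' c'. b' \<noteq> 0 \<and> RFract a b = RFract a' b' \<and> RFract c b = RFract c' b' \<and> z = RFract (a' + c') b'"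
  then obtain a' b' c' where *: "b' \<noteq> 0" "RFract a b = RFract a' b'" "RFract c b = RFract c' b'"
    and z: "z = RFract (a' + c') b'" by blast
  obtain u v where uv: "u \<noteq> 0" "v \<noteq> 0" "b * u = b' * v"
    using common_multiple assms *(1) by blast
  note iff = RFract_eq_iff_common[OF assms *(1) uv]
  show "z = RFract (a + c) b"
    using * iff[of a a'] iff[of c c'] iff[of "a + c" "a' + c'"] z by (simp add: distrib_right)
qed (use assms in blast)

lemma uminus_RFract:
  assumes "b \<noteq> 0"
  shows "- RFract a b = RFract (- a) b"
  unfolding uminus_rfract_def
proof (rule the_equality)
  fix z
  assume "\<exists>a' b'. b' \<noteq> 0 \<and> RFract a b = RFract a' b' \<and> z = RFract (- a') b'"
  then obtain a' b' where *: "b' \<noteq> 0" "RFract a b = RFract a' b'"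
    and z: "z = RFract (- a') b'" by blast
  obtain u v where uv: "u \<noteq> 0" "v \<noteq> 0" "b * u = b' * v"
    using common_multiple assms *(1) by blast
  note iff = RFract_eq_iff_common[OF assms *(1) uv]
  show "z = RFract (- a) b"
    using * iff[of a a'] iff[of "- a" "- a'"] z by simp
qed (use assms in blast)

lemma mult_RFract:
  assumes "b \<noteq> 0" "d \<noteq> 0"
  shows "RFract a b * RFract (b * c) d = RFract (a * c) d"
  unfolding times_rfract_def
proof (rule the_equality)
  fix z
  assume "\<exists>a' b' c' d'. b' \<noteq> 0 \<and> d' \<noteq> 0 \<and> RFract a b = RFract a' b' \<and>
     RFract (b * c) d = RFract (b' * c') d' \<and> z = RFract (a' * c') d'"
  then obtain a' b' c' d' where *: "b' \<noteq> 0" "d' \<noteq> 0" "RFract a b = RFract a' b'"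
     "RFract (b * c) d = RFract (b' * c') d'" and z: "z = RFract (a' * c') d'" by blast
  obtain u v where uv: "u \<noteq> 0" "v \<noteq> 0" "d * u = d' * v"
    using common_multiple assms *(2) by blast
  note iff = RFract_eq_iff_common[OF assms(2) *(2) uv]
  have eq: "b * (c * u) = b' * (c' * v)"
    using iff[of "b * c" "b' * c'"] * by (simp add: mult.assoc)
  have "a * (c * u) = a' * (c' * v)"
  proof (cases "c = 0")
    case True
    then have "c' = 0" using eq * uv by simp
    then show ?thesis using True by simp
  next
    case False
    then have "c * u \<noteq> 0" using uv by simp
    moreover from this have "c' * v \<noteq> 0" using eq assms by (metis mult_eq_0_iff)
    ultimately show ?thesis
      using RFract_eq_iff_common[OF assms(1) *(1) _ _ eq] * by blast
  qed
  then show "z = RFract (a * c) d"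
    using iff[of "a * c" "a' * c'"] z by (simp add: mult.assoc)
qed (use assms in blast)

lemma RFract_eq_0_iff: "b \<noteq> 0 \<Longrightarrow> RFract a b = 0 \<longleftrightarrow> a = 0"
  unfolding zero_rfract_def by (subst RFract_eq_iff_common[of _ _ 1 b]) auto

lemma RFract_self: "b \<noteq> 0 \<Longrightarrow> RFract b b = 1"
  unfolding one_rfract_def by (subst RFract_eq_iff_common[of _ _ 1 b]) auto

lemma inverse_RFract:
  assumes "a \<noteq> 0" "b \<noteq> 0"
  shows "inverse (RFract a b) = RFract b a"
proof -
  have "(THE z. \<exists>a' b'. a' \<noteq> 0 \<and> b' \<noteq> 0 \<and> RFract a b = RFract a' b' \<and> z = RFract b' a') = RFract b a"
  proof (rule the_equality)
    fix z
    assume "\<exists>a' b'. a' \<noteq> 0 \<and> b' \<noteq> 0 \<and> RFract a b = RFract a' b' \<and> z = RFract b' a'"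
    then obtain a' b' where *: "a' \<noteq> 0" "b' \<noteq> 0" "RFract a b = RFract a' b'" "z = RFract b' a'"
      by blast
    obtain u v where "u \<noteq> 0" "v \<noteq> 0" "b * u = b' * v" "a * u = a' * v"
      using * RFract_eq_iff[OF assms(2) *(2), of a a'] by blast
    then show "z = RFract b a"
      unfolding *(4) RFract_eq_iff[OF *(1) assms(1)] by metis
  qed (use assms in blast)
  then show ?thesis using assms by (simp add: inverse_rfract_def RFract_eq_0_iff)
qed

instance rfract :: (right_ore_domain) division_ring
proof
  fix x y z :: "'a rfract"
  show "x + y = y + x"
  proof -
    obtain a c b where "x = RFract a b" "y = RFract c b" "b \<noteq> 0"
      by (rule RFract_common_denominator)
    then show ?thesis by (simp add: add_RFract add.commute)
  qed
  have add_form: "\<exists>a c e b. x = RFract a b \<and> y = RFract c b \<and> z = RFract e b \<and> b \<noteq> 0"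
  proof -
    obtain a c b where 1: "x = RFract a b" "y = RFract c b" "b \<noteq> 0"
      by (rule RFract_common_denominator)
    obtain e d where 2: "z = RFract e d" "d \<noteq> 0" by (rule RFract_cases)
    obtain u v where uv: "u \<noteq> 0" "v \<noteq> 0" "b * u = d * v"
      using common_multiple 1 2 by blast
    have "x = RFract (a * u) (b * u)" "y = RFract (c * u) (b * u)"
      by (simp_all only: 1 RFract_expand[OF uv(1) 1(3)])
    moreover have "z = RFract (e * v) (b * u)"
      by (simp only: 2 uv(3) RFract_expand[OF uv(2) 2(2)])
    moreover have "b * u \<noteq> 0" using 1(3) uv(1) by simp
    ultimately show ?thesis by blast
  qed
  then show "x + y + z = x + (y + z)"
    by (auto simp: add_RFract add.assoc)
  show "0 + x = x"
  proof -
    obtain a b where x: "x = RFract a b" "b \<noteq> 0" by (rule RFract_cases)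
    moreover have "0 = RFract 0 b" using x RFract_eq_0_iff by metis
    ultimately show ?thesis using add_RFract[of b 0 a] by simp
  qed
  show "- x + x = 0"
  proof -
    obtain a b where x: "x = RFract a b" "b \<noteq> 0" by (rule RFract_cases)
    then show ?thesis by (simp add: add_RFract uminus_RFract RFract_eq_0_iff)
  qed
  show "x - y = x + - y" by (simp add: minus_rfract_def)
  show "x * y * z = x * (y * z)"
  proof -
    obtain a b where x: "x = RFract a b" "b \<noteq> 0" by (rule RFract_cases)
    obtain c d where y: "y = RFract (b * c) d" "d \<noteq> 0"
      using RFract_common_middle[OF x(2)] by blast
    obtain e f where z: "z = RFract (d * e) f" "f \<noteq> 0"
      using RFract_common_middle[OF y(2)] by blast
    have "x * y * z = RFract (a * c * e) f"
      using x y z by (simp add: mult_RFract)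
    moreover have "y * z = RFract (b * (c * e)) f"
      using mult_RFract[OF y(2) z(2), of "b * c" e] y z by (simp add: mult.assoc)
    then have "x * (y * z) = RFract (a * (c * e)) f"
      using x z by (simp add: mult_RFract)
    ultimately show ?thesis by (simp add: mult.assoc)
  qed
  show "1 * x = x"
  proof -
    obtain a b where x: "x = RFract a b" "b \<noteq> 0" by (rule RFract_cases)
    then show ?thesis
      using mult_RFract[of 1 b 1 a] by (simp add: one_rfract_def)
  qed
  show "x * 1 = x"
  proof -
    obtain a b where x: "x = RFract a b" "b \<noteq> 0" by (rule RFract_cases)
    then show ?thesis
      using mult_RFract[of b b a 1] by (simp add: RFract_self)
  qed
  show "(x + y) * z = x * z + y * z"
  proof -
    obtain a c b where xy: "x = RFract a b" "y = RFract c b" "b \<noteq> 0"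
      by (rule RFract_common_denominator)
    obtain e d where z: "z = RFract (b * e) d" "d \<noteq> 0"
      using RFract_common_middle[OF xy(3)] by blast
    show ?thesis using xy z by (simp add: add_RFract mult_RFract distrib_right)
  qed
  show "x * (y + z) = x * y + x * z"
  proof -
    obtain a b where x: "x = RFract a b" "b \<noteq> 0" by (rule RFract_cases)
    obtain p q d where yz: "y = RFract p d" "z = RFract q d" "d \<noteq> 0"
      by (rule RFract_common_denominator)
    obtain u w where u: "u \<noteq> 0" "p * u = b * w" using right_ore[OF x(2)] by blast
    obtain v w' where v: "v \<noteq> 0" "q * u * v = b * w'" using right_ore[OF x(2)] by blast
    have uv: "u * v \<noteq> 0" using u v by simp
    define d' where "d' = d * (u * v)"
    have d': "d' \<noteq> 0" using yz uv by (simp add: d'_def)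
    have y: "y = RFract (b * (w * v)) d'"
      using RFract_expand[OF uv yz(3), of p] u yz by (metis d'_def mult.assoc)
    have z: "z = RFract (b * w') d'"
      using RFract_expand[OF uv yz(3), of q] v yz by (metis d'_def mult.assoc)
    have "y + z = RFract (b * (w * v + w')) d'"
      using y z d' by (simp add: add_RFract distrib_left)
    then have "x * (y + z) = RFract (a * (w * v + w')) d'"
      by (simp only: x mult_RFract[OF x(2) d'])
    moreover have "x * y + x * z = RFract (a * (w * v) + a * w') d'"
      by (simp only: x y z mult_RFract[OF x(2) d'] add_RFract[OF d'])
    ultimately show ?thesis by (simp only: distrib_left)
  qed
  show "(0::'a rfract) \<noteq> 1"
    using RFract_eq_0_iff[of "1::'a" 1] by (simp add: one_rfract_def)
  show "inverse x * x = 1" "x * inverse x = 1" if "x \<noteq> 0"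
  proof -
    obtain a b where x: "x = RFract a b" "b \<noteq> 0" by (rule RFract_cases)
    with that have a: "a \<noteq> 0" by (simp add: RFract_eq_0_iff)
    show "inverse x * x = 1"
      using x a mult_RFract[of a b b 1] by (simp add: inverse_RFract RFract_self)
    show "x * inverse x = 1"
      using x a mult_RFract[of b a a 1] by (simp add: inverse_RFract RFract_self)
  qed
  show "x / y = x * inverse y" by (simp add: divide_rfract_def)
  show "inverse (0::'a rfract) = 0" by (simp add: inverse_rfract_def)
qed

definition to_rfract :: "'a::right_ore_domain \<Rightarrow> 'a rfract" where
  "to_rfract a = RFract a 1"

lemma to_rfract_0 [simp]: "to_rfract 0 = 0"
  and to_rfract_1 [simp]: "to_rfract 1 = 1"
  by (simp_all add: to_rfract_def zero_rfract_def one_rfract_def)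

lemma to_rfract_add: "to_rfract (a + b) = to_rfract a + to_rfract b"
  by (simp add: to_rfract_def add_RFract)

lemma to_rfract_mult: "to_rfract (a * b) = to_rfract a * to_rfract b"
  using mult_RFract[of 1 1 a b] by (simp add: to_rfract_def)

lemma to_rfract_eq_iff [simp]: "to_rfract a = to_rfract b \<longleftrightarrow> a = b"
  unfolding to_rfract_def by (subst RFract_eq_iff_common[of _ _ 1 1]) auto

lemma to_rfract_eq_0_iff [simp]: "to_rfract a = 0 \<longleftrightarrow> a = 0"
  by (simp add: to_rfract_def RFract_eq_0_iff)

lemma RFract_conv_divide: "b \<noteq> 0 \<Longrightarrow> RFract a b = to_rfract a / to_rfract b"
  using mult_RFract[of 1 b a 1]
  by (simp add: to_rfract_def divide_inverse inverse_RFract)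

text \<open>The extension \<open>p q\<^sup>-\<^sup>1 \<mapsto> f p (f q)\<^sup>-\<^sup>1\<close> of an injective ring homomorphism.\<close>

definition rfract_extend ::
    "('a::right_ore_domain \<Rightarrow> 'b::right_ore_domain) \<Rightarrow> 'a rfract \<Rightarrow> 'b rfract" where
  "rfract_extend f x = (THE y. \<exists>p q. q \<noteq> 0 \<and> x = to_rfract p / to_rfract q \<and>
     y = to_rfract (f p) / to_rfract (f q))"

locale inj_ring_hom =
  fixes f :: "'a::right_ore_domain \<Rightarrow> 'b::right_ore_domain"
  assumes hom_add: "f (a + b) = f a + f b"
    and hom_mult: "f (a * b) = f a * f b"
    and hom_one: "f 1 = 1"
    and inj: "inj f"
begin

lemma hom_zero: "f 0 = 0"
  using hom_add[of 0 0] by simp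

lemma hom_eq_0_iff: "f a = 0 \<longleftrightarrow> a = 0"
  by (metis hom_zero inj injD)

lemma rfract_extend_RFract:
  assumes "q \<noteq> 0"
  shows "rfract_extend f (RFract p q) = RFract (f p) (f q)"
  unfolding rfract_extend_def
proof (rule the_equality)
  show "\<exists>p' q'. q' \<noteq> 0 \<and> RFract p q = to_rfract p' / to_rfract q' \<and>
     RFract (f p) (f q) = to_rfract (f p') / to_rfract (f q')"
    using assms by (intro exI[of _ p] exI[of _ q]) (auto simp: RFract_conv_divide hom_eq_0_iff)
next
  fix y
  assume "\<exists>p' q'. q' \<noteq> 0 \<and> RFract p q = to_rfract p' / to_rfract q' \<and>
     y = to_rfract (f p') / to_rfract (f q')"
  then obtain p' q' where *: "q' \<noteq> 0" "RFract p q = RFract p' q'" "y = RFract (f p') (f q')"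
    by (auto simp: RFract_conv_divide hom_eq_0_iff)
  then obtain u v where uv: "u \<noteq> 0" "v \<noteq> 0" "q * u = q' * v" "p * u = p' * v"
    using RFract_eq_iff[OF assms *(1), of p p'] by auto
  have "f q * f u = f q' * f v" "f p * f u = f p' * f v"
    by (simp_all only: uv flip: hom_mult)
  moreover have "f q \<noteq> 0" "f q' \<noteq> 0" "f u \<noteq> 0" "f v \<noteq> 0"
    using assms * uv by (simp_all add: hom_eq_0_iff)
  ultimately show "y = RFract (f p) (f q)"
    unfolding *(3) by (subst RFract_eq_iff_common[of _ _ "f v" "f u"]) simp_all
qed

lemma rfract_extend_divide:
  "q \<noteq> 0 \<Longrightarrow> rfract_extend f (to_rfract p / to_rfract q) = to_rfract (f p) / to_rfract (f q)"
  using rfract_extend_RFract by (simp add: RFract_conv_divide hom_eq_0_iff)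

lemma rfract_extend_to_rfract: "rfract_extend f (to_rfract p) = to_rfract (f p)"
  using rfract_extend_RFract[of 1 p] by (simp add: to_rfract_def hom_one)

lemma rfract_extend_add: "rfract_extend f (x + y) = rfract_extend f x + rfract_extend f y"
proof -
  obtain a c b where "x = RFract a b" "y = RFract c b" "b \<noteq> 0"
    by (rule RFract_common_denominator)
  then show ?thesis
    by (simp add: add_RFract rfract_extend_RFract hom_eq_0_iff hom_add)
qed

lemma rfract_extend_mult: "rfract_extend f (x * y) = rfract_extend f x * rfract_extend f y"
proof -
  obtain a b where x: "x = RFract a b" "b \<noteq> 0" by (rule RFract_cases)
  obtain c d where "y = RFract (b * c) d" "d \<noteq> 0"
    using RFract_common_middle[OF x(2)] by blast
  with x show ?thesis
    by (simp add: mult_RFract rfract_extend_RFract hom_eq_0_iff hom_mult)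
qed

lemma rfract_extend_1: "rfract_extend f 1 = 1"
  using rfract_extend_to_rfract[of 1] by (simp add: hom_one)

lemma inj_rfract_extend: "inj (rfract_extend f)"
proof (rule injI)
  fix x y
  assume *: "rfract_extend f x = rfract_extend f y"
  obtain a c b where xy: "x = RFract a b" "y = RFract c b" "b \<noteq> 0"
    by (rule RFract_common_denominator)
  have fb: "f b \<noteq> 0" using xy by (simp add: hom_eq_0_iff)
  have "RFract (f a) (f b) = RFract (f c) (f b)"
    using * xy by (simp add: rfract_extend_RFract)
  then have "f a = f c"
    using RFract_eq_iff_common[OF fb fb, of 1 1 "f a" "f c"] by simp
  then show "x = y" using xy inj by (auto dest: injD)
qed

end

section \<open>Complex coefficients: the ring with $Ta = \sigma(a)T$\<close>

instantiation complex :: twisted_division_ring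
begin

definition twist_complex :: "complex \<Rightarrow> complex" where "twist = cnj"

instance
proof
  show "bij (twist :: complex \<Rightarrow> complex)"
    unfolding twist_complex_def by (rule involuntory_imp_bij) simp
qed (auto simp: twist_complex_def)

end

type_synonym CT = "complex skew_poly"

type_synonym CT_frac = "complex skew_poly rfract"

definition CT_const :: "complex \<Rightarrow> CT_frac" where
  "CT_const a = to_rfract (smonom a 0)"

section \<open>Hamilton's quaternions\<close>

datatype quat = Quat (qre: real) (qi: real) (qj: real) (qk: real)

instantiation quat :: division_ring
begin

definition "0 = Quat 0 0 0 0"
definition "1 = Quat 1 0 0 0"
definition "x + y = Quat (qre x + qre y) (qi x + qi y) (qj x + qj y) (qk x + qk y)"
definition "x - y = Quat (qre x - qre y) (qi x - qi y) (qj x - qj y) (qk x - qk y)"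
definition "- x = Quat (- qre x) (- qi x) (- qj x) (- qk x)"
definition "x * y = Quat
  (qre x * qre y - qi x * qi y - qj x * qj y - qk x * qk y)
  (qre x * qi y + qi x * qre y + qj x * qk y - qk x * qj y)
  (qre x * qj y - qi x * qk y + qj x * qre y + qk x * qi y)
  (qre x * qk y + qi x * qj y - qj x * qi y + qk x * qre y)"
definition "inverse x =
  (let n = (qre x)\<^sup>2 + (qi x)\<^sup>2 + (qj x)\<^sup>2 + (qk x)\<^sup>2
   in Quat (qre x / n) (- qi x / n) (- qj x / n) (- qk x / n))"
definition "x div y = x * inverse (y :: quat)"

lemmas quat_defs = zero_quat_def one_quat_def plus_quat_def minus_quat_def uminus_quat_def
  times_quat_def inverse_quat_def divide_quat_def

instance
proof
  fix x y z :: quat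
  show "x * y * z = x * (y * z)" by (simp add: quat_defs algebra_simps)
  show "(x + y) * z = x * z + y * z" by (simp add: quat_defs algebra_simps)
  show "x * (y + z) = x * y + x * z" by (simp add: quat_defs algebra_simps)
  show "inverse x * x = 1" "x * inverse x = 1" if x: "x \<noteq> 0"
  proof -
    obtain a b c d where q: "x = Quat a b c d" by (cases x)
    define n where "n = a\<^sup>2 + b\<^sup>2 + c\<^sup>2 + d\<^sup>2"
    have "n \<noteq> 0"
    proof
      assume "n = 0"
      moreover have "a\<^sup>2 \<ge> 0" "b\<^sup>2 \<ge> 0" "c\<^sup>2 \<ge> 0" "d\<^sup>2 \<ge> 0" by simp_all
      ultimately have "a\<^sup>2 = 0" "b\<^sup>2 = 0" "c\<^sup>2 = 0" "d\<^sup>2 = 0"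
        unfolding n_def by linarith+
      then show False using x q by (simp add: quat_defs)
    qed
    moreover have "a * a + b * b + c * c + d * d = n" by (simp add: n_def power2_eq_square)
    ultimately show "inverse x * x = 1" "x * inverse x = 1"
      by (simp_all add: q quat_defs Let_def mult.commute flip: n_def add_divide_distrib diff_divide_distrib)
  qed
qed (auto simp: quat_defs)

end

definition quat_of_complex :: "complex \<Rightarrow> quat" where
  "quat_of_complex z = Quat (Re z) (Im z) 0 0"

definition quat_i :: quat where "quat_i = Quat 0 1 0 0"

definition quat_j :: quat where "quat_j = Quat 0 0 1 0"

definition quat_k :: quat where "quat_k = Quat 0 0 0 1"

lemma quat_relations:
  "quat_i * quat_i = - 1" "quat_j * quat_j = - 1" "quat_k * quat_k = - 1"
  "quat_i * quat_j * quat_k = - 1"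
  by (simp_all add: quat_i_def quat_j_def quat_k_def quat_defs)

text \<open>The twist is trivial on the quaternions, so that \<^typ>\<open>quat skew_poly\<close> is the polynomial
  ring in a central variable.\<close>

instantiation quat :: twisted_division_ring
begin

definition twist_quat :: "quat \<Rightarrow> quat" where "twist x = (x :: quat)"

instance by standard (auto simp: twist_quat_def bij_def inj_def surj_def)

end

lemma twist_pow_quat: "(twist ^^ n) x = (x :: quat)"
  by (induction n) (auto simp: twist_quat_def)

type_synonym HX = "quat skew_poly"

type_synonym HX_frac = "quat skew_poly rfract"

lemma HX_scoeff_mult:
  fixes p q :: HX
  shows "scoeff (p * q) n = (\<Sum>i\<le>n. scoeff p i * scoeff q (n - i))"
  by (simp add: scoeff_mult twist_pow_quat)

lemma HX_central: "smonom (1::quat) 1 * p = p * smonom 1 1"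
proof -
  have "scoeff (smonom 1 1 * p) n = scoeff (p * smonom 1 1) n" for n
  proof -
    have "scoeff (smonom 1 1 * p) n = (\<Sum>i\<le>n. if i = 1 then scoeff p (n - 1) else 0)"
      unfolding HX_scoeff_mult by (rule sum.cong) auto
    also have "\<dots> = (\<Sum>i\<le>n. if i = n - 1 then (if n \<ge> 1 then scoeff p (n - 1) else 0) else 0)"
      by auto
    also have "\<dots> = scoeff (p * smonom 1 1) n"
      unfolding HX_scoeff_mult by (rule sum.cong) auto
    finally show ?thesis .
  qed
  then show ?thesis by (simp add: skew_poly_eq_iff)
qed

section \<open>The embedding $\phi$ and the extension of $\sigma$\<close>

definition phi_poly :: "CT \<Rightarrow> HX" where
  "phi_poly = map_skew (\<lambda>l a. quat_of_complex a * quat_j ^ l)"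

definition phi_frac :: "CT_frac \<Rightarrow> HX_frac" where
  "phi_frac = rfract_extend phi_poly"

definition sigma_quat :: "quat \<Rightarrow> quat" where
  "sigma_quat x = Quat (qre x) (- qi x) (qj x) (- qk x)"

definition sigma_poly :: "HX \<Rightarrow> HX" where
  "sigma_poly = map_skew (\<lambda>l. sigma_quat)"

definition sigma_frac :: "HX_frac \<Rightarrow> HX_frac" where
  "sigma_frac = rfract_extend sigma_poly"

definition sigma_invariant :: "HX_frac set \<Rightarrow> bool" where
  "sigma_invariant S \<longleftrightarrow> sigma_frac ` S = S"

lemma quat_of_complex_hom:
  "quat_of_complex 0 = 0" "quat_of_complex 1 = 1"
  "quat_of_complex (a + b) = quat_of_complex a + quat_of_complex b"
  "quat_of_complex (a * b) = quat_of_complex a * quat_of_complex b"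
  by (simp_all add: quat_of_complex_def quat_defs)

lemma quat_j_commutation: "quat_j ^ n * quat_of_complex a = quat_of_complex ((cnj ^^ n) a) * quat_j ^ n"
proof (induction n arbitrary: a)
  case (Suc n)
  have 1: "quat_j * quat_of_complex b = quat_of_complex (cnj b) * quat_j" for b
    by (simp add: quat_j_def quat_of_complex_def quat_defs)
  have "quat_j ^ Suc n * quat_of_complex a = quat_j * (quat_j ^ n * quat_of_complex a)"
    by (simp add: mult.assoc)
  also have "\<dots> = quat_j * quat_of_complex ((cnj ^^ n) a) * quat_j ^ n"
    by (simp add: Suc mult.assoc)
  also have "\<dots> = quat_of_complex ((cnj ^^ Suc n) a) * quat_j ^ Suc n"
    by (simp add: 1 mult.assoc)
  finally show ?case .
qed simp

lemma scoeff_phi_poly: "scoeff (phi_poly p) n = quat_of_complex (scoeff p n) * quat_j ^ n"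
  unfolding phi_poly_def by (subst scoeff_map_skew) (auto simp: quat_of_complex_hom)

lemma scoeff_sigma_poly: "scoeff (sigma_poly p) n = sigma_quat (scoeff p n)"
  unfolding sigma_poly_def by (subst scoeff_map_skew) (auto simp: sigma_quat_def quat_defs)

lemma sigma_quat_hom:
  "sigma_quat 0 = 0" "sigma_quat 1 = 1"
  "sigma_quat (a + b) = sigma_quat a + sigma_quat b"
  "sigma_quat (a * b) = sigma_quat a * sigma_quat b"
  "sigma_quat (sigma_quat a) = a"
  by (simp_all add: sigma_quat_def quat_defs)

lemma sigma_quat_of_complex: "sigma_quat (quat_of_complex z) = quat_of_complex (cnj z)"
  by (simp add: sigma_quat_def quat_of_complex_def)

interpretation phi_poly: inj_ring_hom phi_poly
proof
  fix a b :: CT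
  show "phi_poly (a + b) = phi_poly a + phi_poly b"
    by (simp add: skew_poly_eq_iff scoeff_phi_poly quat_of_complex_hom distrib_right)
  show "phi_poly (a * b) = phi_poly a * phi_poly b"
    unfolding skew_poly_eq_iff
  proof
    fix n
    have sum: "quat_of_complex (sum f A) = (\<Sum>x\<in>A. quat_of_complex (f x))" for f and A :: "nat set"
      by (induction A rule: infinite_finite_induct) (auto simp: quat_of_complex_hom)
    have "quat_of_complex x * quat_of_complex ((cnj ^^ i) y) * quat_j ^ n =
        quat_of_complex x * quat_j ^ i * (quat_of_complex y * quat_j ^ (n - i))" if "i \<le> n" for x y i
    proof -
      have "quat_j ^ n = quat_j ^ i * quat_j ^ (n - i)" using that by (simp flip: power_add)
      then show ?thesis by (metis mult.assoc quat_j_commutation)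
    qed
    then show "scoeff (phi_poly (a * b)) n = scoeff (phi_poly a * phi_poly b) n"
      by (simp add: scoeff_phi_poly HX_scoeff_mult scoeff_mult twist_complex_def sum
          quat_of_complex_hom sum_distrib_right)
  qed
  show "phi_poly 1 = 1"
    by (simp add: skew_poly_eq_iff scoeff_phi_poly scoeff_1 quat_of_complex_hom)
next
  have "quat_j \<noteq> 0" by (simp add: quat_j_def quat_defs)
  then have "quat_j ^ n \<noteq> 0" for n by simp
  moreover have "inj quat_of_complex"
    by (auto simp: inj_def quat_of_complex_def complex_eq_iff)
  ultimately show "inj phi_poly"
    by (auto simp: inj_def skew_poly_eq_iff scoeff_phi_poly)
qed

interpretation sigma_poly: inj_ring_hom sigma_poly
proof
  fix a b :: HX
  show "sigma_poly (a + b) = sigma_poly a + sigma_poly b"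
    by (simp add: skew_poly_eq_iff scoeff_sigma_poly sigma_quat_hom)
  show "sigma_poly (a * b) = sigma_poly a * sigma_poly b"
    unfolding skew_poly_eq_iff
  proof
    fix n
    have sum: "sigma_quat (sum f A) = (\<Sum>x\<in>A. sigma_quat (f x))" for f and A :: "nat set"
      by (induction A rule: infinite_finite_induct) (auto simp: sigma_quat_hom)
    show "scoeff (sigma_poly (a * b)) n = scoeff (sigma_poly a * sigma_poly b) n"
      by (simp add: scoeff_sigma_poly HX_scoeff_mult sum sigma_quat_hom)
  qed
  show "sigma_poly 1 = 1"
    by (simp add: skew_poly_eq_iff scoeff_sigma_poly scoeff_1 sigma_quat_hom)
next
  show "inj sigma_poly"
    by (metis (no_types, lifting) injI scoeff_sigma_poly sigma_quat_hom(5) skew_poly_eq_iff)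
qed

section \<open>Division subrings\<close>

definition division_subring :: "'a::division_ring set \<Rightarrow> bool" where
  "division_subring S \<longleftrightarrow> 1 \<in> S \<and>
     (\<forall>x\<in>S. \<forall>y\<in>S. x - y \<in> S \<and> x * y \<in> S) \<and> (\<forall>x\<in>S. x \<noteq> 0 \<longrightarrow> inverse x \<in> S)"

lemma division_subring_hull: "division_subring (division_subring hull S)"
  by (rule hull_in) (unfold division_subring_def, blast)

definition CT_generated :: "CT_frac \<Rightarrow> CT_frac set" where
  "CT_generated v = division_subring hull (insert v (range CT_const))"

end

theory Submission
  imports Defs "HOL-Computational_Algebra.Field_as_Ring"
    "HOL-Computational_Algebra.Polynomial_Factorial"
begin

text \<open>Under \<open>\<phi>\<close> the automorphism \<open>\<sigma>\<close> corresponds to conjugating the coefficients of a skew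
  polynomial, since \<open>\<sigma>(j) = j\<close>.  So \<open>L\<close> is stable under this involution, and as \<open>i \<in> L\<close> it splits
  as \<open>L = F + i F\<close> with \<open>F\<close> the fixed elements of \<open>L\<close>.  The fixed elements of \<open>\<complex>(T, \<sigma>)\<close> form the
  commutative field \<open>\<real>(T)\<close>, so Luroth's theorem gives \<open>F = \<real>(v)\<close>, whence \<open>L = \<complex>(v)\<close>.\<close>

section \<open>Division subrings\<close>

context
  fixes S :: "'a::division_ring set"
  assumes S: "division_subring S"
begin

lemma division_subring_1: "1 \<in> S"
  and division_subring_diff: "x \<in> S \<Longrightarrow> y \<in> S \<Longrightarrow> x - y \<in> S"
  and division_subring_mult: "x \<in> S \<Longrightarrow> y \<in> S \<Longrightarrow> x * y \<in> S"
  using S by (auto simp: division_subring_def)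

lemma division_subring_0: "0 \<in> S"
  using division_subring_diff[OF division_subring_1 division_subring_1] by simp

lemma division_subring_uminus: "x \<in> S \<Longrightarrow> - x \<in> S"
  using division_subring_diff[OF division_subring_0] by simp

lemma division_subring_add: "x \<in> S \<Longrightarrow> y \<in> S \<Longrightarrow> x + y \<in> S"
  using division_subring_diff[of x "- y"] division_subring_uminus by simp

lemma division_subring_inverse: "x \<in> S \<Longrightarrow> inverse x \<in> S"
  using S by (cases "x = 0") (auto simp: division_subring_def)

lemma division_subring_divide: "x \<in> S \<Longrightarrow> y \<in> S \<Longrightarrow> x / y \<in> S"
  by (simp add: divide_inverse division_subring_mult division_subring_inverse)

lemmas division_subring_intros =
  division_subring_0 division_subring_1 division_subring_add division_subring_diff
  division_subring_uminus division_subring_mult division_subring_inverse division_subring_divide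

end

section \<open>Polynomials over a subfield\<close>

definition polys_over :: "'a::zero set \<Rightarrow> 'a poly set" where
  "polys_over S = {p. \<forall>i. coeff p i \<in> S}"

lemma polys_over_coeff: "p \<in> polys_over S \<Longrightarrow> coeff p i \<in> S"
  by (simp add: polys_over_def)

context
  fixes S :: "'a::field set"
  assumes S: "division_subring S"
begin

lemma polys_over_diff: "p \<in> polys_over S \<Longrightarrow> q \<in> polys_over S \<Longrightarrow> p - q \<in> polys_over S"
  by (simp add: polys_over_def division_subring_diff[OF S])

lemma polys_over_smult: "c \<in> S \<Longrightarrow> p \<in> polys_over S \<Longrightarrow> smult c p \<in> polys_over S"
  by (simp add: polys_over_def division_subring_mult[OF S])

lemma polys_over_0: "0 \<in> polys_over S"
  by (simp add: polys_over_def division_subring_0[OF S])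

lemma polys_over_pCons: "pCons c p \<in> polys_over S \<longleftrightarrow> c \<in> S \<and> p \<in> polys_over S"
  by (auto simp: polys_over_def coeff_pCons split: nat.splits)

text \<open>Long division stays over \<open>S\<close>: each step only forms a quotient
  \<open>c\<close> of two coefficients and subtracts \<open>c\<close> times the divisor.\<close>

lemma polys_over_div_mod:
  assumes "p \<in> polys_over S" "q \<in> polys_over S"
  shows "p div q \<in> polys_over S \<and> p mod q \<in> polys_over S"
  using assms(1)
proof (induction p)
  case 0
  then show ?case by simp
next
  case (pCons a p)
  then have *: "a \<in> S" "p div q \<in> polys_over S" "p mod q \<in> polys_over S"
    by (simp_all add: polys_over_pCons)
  define c where "c = coeff (pCons a (p mod q)) (degree q) / lead_coeff q"
  have "pCons a (p mod q) \<in> polys_over S" using * by (simp add: polys_over_pCons)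
  moreover from this have "c \<in> S"
    using assms(2) unfolding c_def by (intro division_subring_divide[OF S] polys_over_coeff)
  ultimately show ?case
    using * assms(2) pCons.prems
    by (simp add: div_pCons_eq mod_pCons_eq polys_over_pCons polys_over_diff polys_over_smult
        polys_over_0 flip: c_def)
qed

text \<open>Take a nonzero annihilator of least degree and make it monic. The remainder of any other
  annihilator modulo it again lies over \<open>S\<close> and vanishes at \<open>x\<close>, so by
  minimality it is zero.\<close>

lemma minimal_poly_over:
  assumes "p \<in> polys_over S" "p \<noteq> 0" "poly p x = 0"
  obtains f where "f \<in> polys_over S" "lead_coeff f = 1" "poly f x = 0"
    "\<And>g. g \<in> polys_over S \<Longrightarrow> poly g x = 0 \<Longrightarrow> f dvd g"
proof -
  let ?A = "\<lambda>f. f \<in> polys_over S \<and> f \<noteq> 0 \<and> poly f x = 0"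
  obtain h where h: "?A h" and min: "\<And>g. ?A g \<Longrightarrow> degree h \<le> degree g"
    using ex_has_least_nat[of ?A p degree] assms by blast
  define f where "f = smult (inverse (lead_coeff h)) h"
  have f: "f \<in> polys_over S"
    using h unfolding f_def
    by (intro polys_over_smult division_subring_inverse[OF S] polys_over_coeff) auto
  have deg: "degree f = degree h" using h by (simp add: f_def)
  have "f dvd g" if g: "g \<in> polys_over S" "poly g x = 0" for g
  proof (rule ccontr)
    assume "\<not> f dvd g"
    then have "g mod f \<noteq> 0" by (simp add: mod_eq_0_iff_dvd)
    moreover have "poly (g mod f) x = 0"
      using g h by (simp add: f_def poly_mod)
    moreover have "g mod f \<in> polys_over S" using polys_over_div_mod g f by blast
    ultimately have "degree f \<le> degree (g mod f)" using min deg by simp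
    moreover have "degree (g mod f) < degree f"
      using degree_mod_less[of f g] \<open>g mod f \<noteq> 0\<close> h by (simp add: f_def)
    ultimately show False by simp
  qed
  moreover have "lead_coeff f = 1" "poly f x = 0" using h by (auto simp: f_def)
  ultimately show thesis using that f by blast
qed

end

section \<open>Bivariate polynomials\<close>

text \<open>Upper bounds replace the exact degrees because it is applied to inner coefficients,
  whose degrees may fall short of the maximum.\<close>

lemma coeff_mult_degree_bounds:
  fixes p q :: "'a::comm_semiring_0 poly"
  assumes "degree p \<le> m" "degree q \<le> n"
  shows "coeff (p * q) (m + n) = coeff p m * coeff q n"
proof -
  have "coeff (p * q) (m + n) = (\<Sum>i\<le>m+n. if i = m then coeff p m * coeff q n else 0)"
    unfolding coeff_mult
  proof (rule sum.cong)
    fix i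
    have "i < m \<Longrightarrow> m + n - i > n" by linarith
    then show "coeff p i * coeff q (m + n - i) = (if i = m then coeff p m * coeff q n else 0)"
      using assms by (cases i m rule: linorder_cases) (simp_all add: coeff_eq_0)
  qed simp
  then show ?thesis by simp
qed

text \<open>The degree with respect to the inner variable is additive, because the top coefficients
  in that variable multiply in \<open>'a poly\<close>.\<close>

lemma inner_degree_const_if_factor:
  fixes g q :: "'a::idom poly poly"
  assumes "g \<noteq> 0" "g * q \<noteq> 0"
    and bound: "\<And>i. \<exists>j. degree (coeff (g * q) i) \<le> degree (coeff g j)"
  shows "degree (coeff q i) = 0"
proof -
  define inner :: "'a poly poly \<Rightarrow> nat" where "inner p = Max ((\<lambda>i. degree (coeff p i)) ` {..degree p})" for p
  have inner_le: "degree (coeff p i) \<le> inner p" for p :: "'a poly poly" and i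
  proof (cases "i \<le> degree p")
    case True
    then show ?thesis unfolding inner_def by (intro Max_ge) auto
  qed (simp add: coeff_eq_0)
  have inner_ex: "\<exists>i. coeff (coeff p i) (inner p) \<noteq> 0" if "p \<noteq> 0" for p :: "'a poly poly"
  \<comment> \<open>Degree 0 does not exclude a zero coefficient, so when the maximum is 0 the
    leading coefficient serves as witness.\<close>
  proof (cases "inner p = 0")
    case True
    then have "degree (lead_coeff p) = 0" using inner_le[of p "degree p"] by simp
    then show ?thesis
      using True that by (metis leading_coeff_0_iff)
  next
    case False
    have "inner p \<in> (\<lambda>i. degree (coeff p i)) ` {..degree p}"
      unfolding inner_def by (intro Max_in) auto
    then obtain i where "inner p = degree (coeff p i)" by blast
    then show ?thesis
      using False by (metis degree_0 leading_coeff_0_iff)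
  qed
  \<comment> \<open>\<open>top n p\<close> collects the coefficients of the \<open>n\<close>-th
    power of the inner variable into a polynomial in the outer one.\<close>
  define top where "top n p = map_poly (\<lambda>c. coeff c n) p" for n and p :: "'a poly poly"
  have top_coeff: "coeff (top n p) i = coeff (coeff p i) n" for n p i
    by (simp add: top_def coeff_map_poly)
  have "q \<noteq> 0" using assms(2) by auto
  have "top (inner g + inner q) (g * q) = top (inner g) g * top (inner q) q"
    by (rule poly_eqI)
      (simp add: top_coeff coeff_mult[of g q] coeff_mult[of "top _ _"] coeff_sum
        coeff_mult_degree_bounds inner_le)
  moreover have "top (inner g) g \<noteq> 0" "top (inner q) q \<noteq> 0"
    using inner_ex assms(1) \<open>q \<noteq> 0\<close> top_coeff by (metis coeff_0)+
  ultimately have "top (inner g + inner q) (g * q) \<noteq> 0" by simp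
  then obtain k where "coeff (coeff (g * q) k) (inner g + inner q) \<noteq> 0"
    by (metis poly_eqI coeff_0 top_coeff)
  then have "inner g + inner q \<le> degree (coeff (g * q) k)" by (rule le_degree)
  also obtain j where "\<dots> \<le> degree (coeff g j)" using bound by blast
  also have "\<dots> \<le> inner g" by (rule inner_le)
  finally show ?thesis using inner_le[of q i] by simp
qed

section \<open>Luroth's theorem\<close>

definition fract_const :: "'a::field \<Rightarrow> 'a poly fract" where
  "fract_const c = to_fract [:c:]"

abbreviation fract_const_poly :: "'a::field poly \<Rightarrow> 'a poly fract poly" where
  "fract_const_poly \<equiv> map_poly fract_const"

lemma fract_const_hom [simp]:
  "fract_const 0 = 0" "fract_const 1 = 1"
  "fract_const (a + b) = fract_const a + fract_const b"
  "fract_const (a - b) = fract_const a - fract_const b"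
  "fract_const (a * b) = fract_const a * fract_const b"
  by (simp_all add: fract_const_def flip: to_fract_add to_fract_diff to_fract_mult one_pCons)

lemma fract_const_eq_iff [simp]: "fract_const a = fract_const b \<longleftrightarrow> a = b"
  by (simp add: fract_const_def)

lemma fract_const_inverse: "fract_const (inverse a) = inverse (fract_const a)"
proof (cases "a = 0")
  case False
  then have "fract_const a * fract_const (inverse a) = 1"
    by (simp flip: fract_const_hom)
  then show ?thesis by (metis inverse_unique)
qed simp

lemma division_subring_fract_const: "division_subring (range fract_const)"
  unfolding division_subring_def
  by (auto simp flip: fract_const_hom fract_const_inverse)

text \<open>Renames the variable y to x. As \<open>to_fract\<close> is injective, x is therefore
  transcendental over the constants.\<close>

lemma poly_fract_const_poly: "poly (fract_const_poly p) (to_fract [:0, 1:]) = to_fract p"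
proof (induction p)
  case (pCons a p)
  have "to_fract (pCons a p) = to_fract ([:a:] + [:0, 1:] * p)" by simp
  also have "\<dots> = fract_const a + to_fract [:0, 1:] * to_fract p"
    by (simp only: to_fract_add to_fract_mult fract_const_def)
  finally show ?case by (simp add: map_poly_pCons pCons.IH)
qed simp

lemma fract_const_poly_in: "range fract_const \<subseteq> S \<Longrightarrow> fract_const_poly p \<in> polys_over S"
  by (auto simp: polys_over_def coeff_map_poly)

text \<open>The minimal polynomial \<open>f\<close> of the variable \<open>x\<close> over \<open>F\<close> has a nonconstant coefficient
  \<open>v = P / Q\<close>, where \<open>P\<close> and \<open>Q\<close> are coefficients of its primitive part \<open>g\<close> in \<open>k[x][y]\<close>.
  By Gauss's lemma \<open>g\<close> divides \<open>P(x) Q(y) - Q(x) P(y)\<close>, and the cofactor is free of \<open>x\<close> for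
  degree reasons.  Hence \<open>f\<close> has coefficients in \<open>k(v)\<close>, and reduction modulo \<open>f\<close> expresses
  every element of \<open>F\<close> as a quotient of two elements of \<open>k(v)\<close>.\<close>

theorem Luroth:
  fixes F :: "'a::field_gcd poly fract set"
  assumes F: "division_subring F" and const_F: "range fract_const \<subseteq> F"
  obtains v where "F = division_subring hull (insert v (range fract_const))"
proof (cases "F \<subseteq> range fract_const")
  case True
  have "division_subring hull (insert 0 (range fract_const)) \<subseteq> F"
    by (rule hull_minimal) (use const_F division_subring_0[OF F] F in auto)
  moreover have "F \<subseteq> division_subring hull (insert 0 (range fract_const))"
    using True hull_subset[of "insert 0 (range fract_const)" division_subring] by blast
  ultimately show thesis using that by blast
next
  case False
  let ?x = "to_fract [:0, 1:] :: 'a poly fract"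
  \<comment> \<open>For \<open>w = A / B\<close>, the polynomial w B(y) - A(y) annihilates
    x.\<close>
  have relation: "smult w (fract_const_poly B) - fract_const_poly A \<in> polys_over G"
    "poly (smult w (fract_const_poly B) - fract_const_poly A) ?x = 0"
    if "division_subring G" "range fract_const \<subseteq> G" "w \<in> G" "w = to_fract A / to_fract B" "B \<noteq> 0"
    for w A B G
    using that
    by (auto intro!: polys_over_diff polys_over_smult fract_const_poly_in simp: poly_fract_const_poly)
  \<comment> \<open>If it vanished, its coefficient at \<open>degree B\<close> would show
    \<open>w\<close> to be a quotient of two constants.\<close>
  have relation_nonzero: "smult w (fract_const_poly B) - fract_const_poly A \<noteq> 0"
    if "w \<notin> range fract_const" "B \<noteq> 0" for w A B
  proof
    assume "smult w (fract_const_poly B) - fract_const_poly A = 0"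
    then have "coeff (smult w (fract_const_poly B)) (degree B) = coeff (fract_const_poly A) (degree B)"
      by simp
    then have "w * fract_const (lead_coeff B) = fract_const (coeff A (degree B))"
      by (simp add: coeff_map_poly)
    moreover have "fract_const (lead_coeff B) \<noteq> 0"
      using that by (metis fract_const_eq_iff fract_const_hom(1) leading_coeff_0_iff)
    ultimately have "w = fract_const (coeff A (degree B)) / fract_const (lead_coeff B)"
      by (simp add: field_simps)
    then show False
      using that by (metis division_subring_divide[OF division_subring_fract_const] rangeI)
  qed
  have quotient: "\<exists>A B. B \<noteq> 0 \<and> w = to_fract A / to_fract B" for w :: "'a poly fract"
    by (cases w) (auto simp: Fract_conv_to_fract)

  \<comment> \<open>A nonconstant element of \<open>F\<close> makes x algebraic over
    \<open>F\<close>.\<close>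
  obtain w0 A0 B0 where w0: "w0 \<in> F" "w0 \<notin> range fract_const" "B0 \<noteq> 0" "w0 = to_fract A0 / to_fract B0"
    using False quotient by blast
  obtain f where f: "f \<in> polys_over F" "lead_coeff f = 1" "poly f ?x = 0"
    and f_dvd: "\<And>g. g \<in> polys_over F \<Longrightarrow> poly g ?x = 0 \<Longrightarrow> f dvd g"
    using minimal_poly_over[OF F relation(1) _ relation(2)] relation_nonzero w0 F const_F by metis
  have "f \<noteq> 0" using f(2) by auto

  \<comment> \<open>Otherwise \<open>f\<close> would be a nonzero polynomial over the constants with
    root x, against transcendence.\<close>
  have "\<exists>i. coeff f i \<notin> range fract_const"
  proof (rule ccontr)
    assume "\<not> ?thesis"
    then have "\<forall>i. \<exists>c. coeff f i = fract_const c" by blast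
    then obtain c where c: "\<And>i. coeff f i = fract_const (c i)" by metis
    have "f = fract_const_poly (Poly (map c [0..<Suc (degree f)]))"
    proof (rule poly_eqI)
      fix i
      show "coeff f i = coeff (fract_const_poly (Poly (map c [0..<Suc (degree f)]))) i"
        by (cases "i < Suc (degree f)")
          (simp_all add: c[symmetric] coeff_map_poly nth_default_def coeff_eq_0 del: upt_Suc)
    qed
    then obtain p where p: "f = fract_const_poly p" by blast
    then show False using f(3) \<open>f \<noteq> 0\<close> by (simp add: poly_fract_const_poly)
  qed
  then obtain i where i: "coeff f i \<notin> range fract_const" by blast
  define v where "v = coeff f i"
  define K where "K = division_subring hull (insert v (range fract_const))"
  have K: "division_subring K" unfolding K_def by (rule division_subring_hull)
  have K_sup: "v \<in> K" "range fract_const \<subseteq> K"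
    using hull_subset[of "insert v (range fract_const)" division_subring] by (auto simp: K_def)
  have v: "v \<in> F" using f(1) by (simp add: v_def polys_over_coeff)
  then have K_F: "K \<subseteq> F"
    unfolding K_def by (intro hull_minimal) (use const_F F in auto)

  define g where "g = primitive_part_fract f"
  define c where "c = fract_content f"
  have fg: "f = smult c (map_poly to_fract g)"
    by (simp add: g_def c_def content_times_primitive_part_fract)
  have coeff_f: "coeff f j = c * to_fract (coeff g j)" for j
    by (simp add: fg coeff_map_poly)
  define P where "P = coeff g i"
  \<comment> \<open>\<open>Q\<close> sits at the leading position of the monic \<open>f\<close>, so
    the content \<open>c\<close> is its inverse. \<open>P\<close> and \<open>Q\<close> need not be
    coprime.\<close>
  define Q where "Q = coeff g (degree f)"
  have Q1: "c * to_fract Q = 1" using coeff_f[of "degree f"] f(2) by (simp add: Q_def)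
  then have Q0: "Q \<noteq> 0" by auto
  have vPQ: "v = to_fract P / to_fract Q"
    using coeff_f[of i] Q1 Q0 by (simp add: v_def P_def field_simps)
  define H where "H = smult v (fract_const_poly Q) - fract_const_poly P"
  have H: "H \<in> polys_over K" "poly H ?x = 0" "H \<noteq> 0"
    using relation[OF K K_sup(2,1) vPQ Q0] relation_nonzero[OF _ Q0] i
    by (auto simp: H_def v_def)
  \<comment> \<open>\<open>H\<close> cleared of its denominator: D = P(x) Q(y) - Q(x) P(y), with x
    the inner variable.\<close>
  define D where "D = smult P (map_poly (\<lambda>a. [:a:]) Q) - smult Q (map_poly (\<lambda>a. [:a:]) P)"
  have DH: "map_poly to_fract D = smult (to_fract Q) H"
    using Q0
    by (intro poly_eqI) (simp add: D_def H_def coeff_map_poly vPQ fract_const_def field_simps)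
  have "f dvd H" by (rule f_dvd) (use H K_F in \<open>auto simp: polys_over_def\<close>)
  then have "map_poly to_fract g dvd map_poly to_fract D"
    unfolding DH fg by (metis dvd_smult smult_dvd_cancel)
  then have "g dvd D"
    using \<open>f \<noteq> 0\<close> by (intro fract_poly_dvdD) (simp_all add: g_def)
  then obtain q where q: "D = g * q" by (rule dvdE)
  have "D \<noteq> 0" using DH H(3) Q0 by auto
  have "degree (coeff q j) = 0" for j
  proof (rule inner_degree_const_if_factor[of g])
    show "g \<noteq> 0" "g * q \<noteq> 0" using \<open>D \<noteq> 0\<close> q by auto
    fix l
    \<comment> \<open>In x, the coefficients of \<open>D\<close> are constant combinations of
      \<open>P\<close> and \<open>Q\<close>, which are themselves coefficients of
      \<open>g\<close>.\<close>
    have "degree (coeff D l) \<le> max (degree P) (degree Q)"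
      unfolding D_def
      by (simp add: coeff_map_poly) (meson degree_diff_le_max degree_smult_le max.mono order_trans)
    then show "\<exists>j. degree (coeff (g * q) l) \<le> degree (coeff g j)"
      unfolding q P_def Q_def by (metis max_def)
  qed
  then have "to_fract (coeff q j) \<in> range fract_const" for j
    unfolding fract_const_def by (metis degree_0_id rangeI)
  then have q_K: "map_poly to_fract q \<in> polys_over K"
    using K_sup(2) by (auto simp: polys_over_def coeff_map_poly)
  have "f * map_poly to_fract q = smult c (map_poly to_fract D)"
    by (simp add: fg q)
  also have "\<dots> = H" by (simp add: DH Q1)
  \<comment> \<open>Dividend and divisor both lie over \<open>K\<close>, hence so does
    \<open>f\<close>.\<close>
  finally have "f = H div map_poly to_fract q"
    using H(3) by (metis nonzero_mult_div_cancel_right mult_zero_right)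
  then have f_K: "f \<in> polys_over K" using polys_over_div_mod[OF K H(1) q_K] by simp

  have "u \<in> K" if u: "u \<in> F" for u
  proof -
    obtain A B where AB: "B \<noteq> 0" "u = to_fract A / to_fract B" using quotient by blast
    \<comment> \<open>Reducing u B(y) - A(y) modulo \<open>f\<close> gives u r(B) = r(A) with both
      remainders over \<open>K\<close>; comparing one nonzero coefficient of r(B) recovers
      \<open>u\<close>.\<close>
    let ?r = "\<lambda>p. fract_const_poly p mod f"
    have r_K: "?r p \<in> polys_over K" for p
      using polys_over_div_mod[OF K fract_const_poly_in[OF K_sup(2)] f_K] by blast
    have "f dvd smult u (fract_const_poly B) - fract_const_poly A"
      using relation[OF F const_F u AB(2,1)] by (intro f_dvd)
    then have "smult u (?r B) = ?r A"
      by (simp add: poly_mod_diff_left mod_smult_left flip: mod_eq_0_iff_dvd)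
    moreover have "?r B \<noteq> 0"
    proof
      assume "?r B = 0"
      then have "poly (fract_const_poly B) ?x = 0"
        using f(3) by (metis dvd_def mod_eq_0_iff_dvd mult_zero_left poly_mult)
      then show False using AB by (simp add: poly_fract_const_poly)
    qed
    then obtain j where j: "coeff (?r B) j \<noteq> 0" by (metis leading_coeff_0_iff)
    ultimately have "u = coeff (?r A) j / coeff (?r B) j"
      by (metis coeff_smult nonzero_mult_div_cancel_right)
    then show ?thesis
      using r_K by (simp add: division_subring_divide[OF K] polys_over_coeff)
  qed
  then show thesis using that K_F unfolding K_def by blast
qed

section \<open>Coefficientwise conjugation of skew polynomials\<close>

definition cnj_skew :: "CT \<Rightarrow> CT" where
  "cnj_skew = map_skew (\<lambda>_. cnj)"

lemma scoeff_cnj_skew [simp]: "scoeff (cnj_skew p) n = cnj (scoeff p n)"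
  unfolding cnj_skew_def by (subst scoeff_map_skew) auto

lemma cnj_skew_cnj_skew [simp]: "cnj_skew (cnj_skew p) = p"
  by (simp add: skew_poly_eq_iff)

lemma cnj_skew_smonom [simp]: "cnj_skew (smonom a n) = smonom (cnj a) n"
  by (simp add: skew_poly_eq_iff)

text \<open>Makes coefficientwise conjugation compatible with the twisted product.\<close>

lemma twist_pow_complex_cnj: "(twist ^^ n) (cnj a) = cnj ((twist ^^ n) a)"
  by (induction n) (auto simp: twist_complex_def)

lemma twist_pow_complex_of_real [simp]: "(twist ^^ n) (complex_of_real r) = of_real r"
  by (induction n) (auto simp: twist_complex_def)

interpretation cnj_skew: inj_ring_hom cnj_skew
proof
  fix a b :: CT
  show "cnj_skew (a + b) = cnj_skew a + cnj_skew b"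
    by (simp add: skew_poly_eq_iff)
  show "cnj_skew (a * b) = cnj_skew a * cnj_skew b"
    by (simp add: skew_poly_eq_iff scoeff_mult twist_pow_complex_cnj)
  show "cnj_skew 1 = 1"
    by (simp add: skew_poly_eq_iff scoeff_1)
  show "inj cnj_skew"
    by (metis cnj_skew_cnj_skew injI)
qed

lemma sigma_poly_phi_poly: "sigma_poly (phi_poly p) = phi_poly (cnj_skew p)"
proof -
  have "sigma_quat (quat_j ^ n) = quat_j ^ n" for n
    by (induction n) (simp_all add: sigma_quat_hom, simp add: sigma_quat_def quat_j_def)
  then show ?thesis
    by (simp add: skew_poly_eq_iff scoeff_sigma_poly scoeff_phi_poly sigma_quat_hom sigma_quat_of_complex)
qed

definition cnj_frac :: "CT_frac \<Rightarrow> CT_frac" where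
  "cnj_frac = rfract_extend cnj_skew"

lemmas cnj_frac_RFract = cnj_skew.rfract_extend_RFract[folded cnj_frac_def]
lemmas cnj_frac_add = cnj_skew.rfract_extend_add[folded cnj_frac_def]
lemmas cnj_frac_mult = cnj_skew.rfract_extend_mult[folded cnj_frac_def]

lemma cnj_frac_cnj_frac [simp]: "cnj_frac (cnj_frac x) = x"
  by (cases x rule: RFract_cases) (simp add: cnj_frac_RFract cnj_skew.hom_eq_0_iff)

lemma cnj_frac_CT_const [simp]: "cnj_frac (CT_const a) = CT_const (cnj a)"
  by (simp add: CT_const_def cnj_frac_def cnj_skew.rfract_extend_to_rfract)

lemma cnj_frac_diff: "cnj_frac (x - y) = cnj_frac x - cnj_frac y"
  using cnj_frac_add[of "x - y" y] by (simp add: algebra_simps)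

lemma sigma_frac_phi_frac: "sigma_frac (phi_frac x) = phi_frac (cnj_frac x)"
  by (cases x rule: RFract_cases)
    (simp add: sigma_frac_def phi_frac_def cnj_frac_RFract phi_poly.rfract_extend_RFract
      sigma_poly.rfract_extend_RFract phi_poly.hom_eq_0_iff cnj_skew.hom_eq_0_iff sigma_poly_phi_poly)

lemma CT_const_hom:
  "CT_const 0 = 0" "CT_const 1 = 1"
  "CT_const (a + b) = CT_const a + CT_const b"
  "CT_const (a * b) = CT_const a * CT_const b"
proof -
  have "smonom 0 0 = (0 :: CT)" "smonom (a + b) 0 = smonom a 0 + (smonom b 0 :: CT)"
    by (simp_all add: skew_poly_eq_iff)
  then show "CT_const 0 = 0" "CT_const 1 = 1"
    "CT_const (a + b) = CT_const a + CT_const b" "CT_const (a * b) = CT_const a * CT_const b"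
    by (simp_all add: CT_const_def smonom_mult_smonom flip: one_skew_poly_def to_rfract_add to_rfract_mult)
qed

section \<open>The fraction field of the real polynomials inside the skew fractions\<close>

definition real_skew :: "real poly \<Rightarrow> CT" where
  "real_skew p = Skew (map_poly complex_of_real p)"

lemma scoeff_real_skew [simp]: "scoeff (real_skew p) n = of_real (coeff p n)"
  by (simp add: real_skew_def scoeff.rep_eq Skew_inverse coeff_map_poly)

text \<open>Real coefficients are fixed by every power of \<open>twist\<close>, so on them the
  twisted product is the ordinary one.\<close>

lemma real_skew_hom:
  "real_skew 1 = 1"
  "real_skew (p + q) = real_skew p + real_skew q"
  "real_skew (p * q) = real_skew p * real_skew q"
  by (simp_all add: skew_poly_eq_iff scoeff_1 coeff_1 scoeff_mult coeff_mult)

lemma real_skew_eq_0_iff [simp]: "real_skew p = 0 \<longleftrightarrow> p = 0"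
  by (simp add: skew_poly_eq_iff poly_eq_iff)

lemma real_skew_const: "real_skew [:c:] = smonom (of_real c) 0"
  by (auto simp: skew_poly_eq_iff coeff_pCons split: nat.splits)

lemma cnj_skew_fixed:
  assumes "cnj_skew p = p"
  obtains r where "p = real_skew r"
proof
  have "Im (scoeff p n) = 0" for n
    using scoeff_cnj_skew[of p n] assms by (simp add: complex_eq_iff)
  moreover have "scoeff p n = coeff (poly_of_skew p) n" for n
    by (simp add: scoeff.rep_eq)
  ultimately show "p = real_skew (map_poly Re (poly_of_skew p))"
    by (simp add: skew_poly_eq_iff coeff_map_poly complex_eq_iff)
qed

text \<open>The normalised representative merely fixes a choice; \<open>real_frac_Fract\<close>
  allows any other.\<close>

definition real_frac :: "real poly fract \<Rightarrow> CT_frac" where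
  "real_frac z = RFract (real_skew (fst (quot_of_fract z))) (real_skew (snd (quot_of_fract z)))"

lemma real_frac_Fract:
  assumes "q \<noteq> 0"
  shows "real_frac (Fract p q) = RFract (real_skew p) (real_skew q)"
proof -
  define a b where "a = fst (quot_of_fract (Fract p q))" and "b = snd (quot_of_fract (Fract p q))"
  have b: "b \<noteq> 0" by (simp add: b_def)
  have "Fract a b = Fract p q"
    unfolding a_def b_def by (metis Fract_quot_of_fract)
  then have "a * q = p * b" using assms b by (simp add: eq_fract)
  then have "RFract (real_skew a) (real_skew b) = RFract (real_skew p) (real_skew q)"
    using assms b
    \<comment> \<open>The denominators commute, so each serves as the multiplier for the
      other.\<close>
    by (subst RFract_eq_iff_common[of _ _ "real_skew q" "real_skew b"])
      (simp_all add: mult.commute flip: real_skew_hom)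
  then show ?thesis by (simp add: real_frac_def a_def b_def)
qed

lemma real_frac_add: "real_frac (x + y) = real_frac x + real_frac y"
proof -
  obtain a b where x: "x = Fract a b" "b \<noteq> 0" by (cases x)
  obtain c d where y: "y = Fract c d" "d \<noteq> 0" by (cases y)
  have xy: "x = Fract (a * d) (b * d)" "y = Fract (c * b) (b * d)" "b * d \<noteq> 0"
    using x y by (auto simp: eq_fract)
  have "x + y = Fract (a * d + c * b) (b * d)" using x y by simp
  moreover have "real_skew (b * d) \<noteq> 0" unfolding real_skew_eq_0_iff by (rule xy(3))
  ultimately show ?thesis
    unfolding xy(1,2) by (simp only: real_frac_Fract[OF xy(3)] add_RFract[of "real_skew (b * d)"]
        real_skew_hom(2) not_False_eq_True)
qed

lemma real_frac_mult: "real_frac (x * y) = real_frac x * real_frac y"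
proof -
  obtain a b where x: "x = Fract a b" "b \<noteq> 0" by (cases x)
  obtain c d where y: "y = Fract c d" "d \<noteq> 0" by (cases y)
  \<comment> \<open>Expanding by \<open>b\<close> gives the numerator the left factor that
    \<open>mult_RFract\<close> requires.\<close>
  have y': "y = Fract (b * c) (b * d)" "b * d \<noteq> 0" using x y by (auto simp: eq_fract)
  have "x * y = Fract (a * c) (b * d)" using x y by simp
  then have "real_frac (x * y) = RFract (real_skew a * real_skew c) (real_skew (b * d))"
    using real_frac_Fract[OF y'(2), of "a * c"] by (simp only: real_skew_hom(3))
  also have "\<dots> = RFract (real_skew a) (real_skew b) * RFract (real_skew b * real_skew c) (real_skew (b * d))"
    using x(2) y'(2) by (intro mult_RFract[symmetric]) (simp_all only: real_skew_eq_0_iff not_False_eq_True)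
  also have "\<dots> = real_frac x * real_frac y"
    by (simp only: x(1) y'(1) real_frac_Fract[OF x(2)] real_frac_Fract[OF y'(2)] real_skew_hom(3))
  finally show ?thesis .
qed

lemma real_frac_const: "real_frac (fract_const c) = CT_const (of_real c)"
  by (simp add: fract_const_def to_fract_def real_frac_Fract CT_const_def to_rfract_def real_skew_const real_skew_hom)

lemma real_frac_0 [simp]: "real_frac 0 = 0"
  using real_frac_add[of 0 0] by simp

lemma real_frac_1 [simp]: "real_frac 1 = 1"
  using real_frac_const[of 1] by (simp add: CT_const_hom)

lemma real_frac_diff: "real_frac (x - y) = real_frac x - real_frac y"
  using real_frac_add[of "x - y" y] by (simp add: algebra_simps)

lemma real_frac_inverse: "real_frac (inverse x) = inverse (real_frac x)"
proof (cases "x = 0")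
  case False
  then have "real_frac x * real_frac (inverse x) = 1"
    by (simp flip: real_frac_mult)
  then show ?thesis by (metis inverse_unique)
qed simp

text \<open>Turns a division subring of the skew fractions into a subfield of \<real>(T), to which
  \<open>Luroth\<close> applies.\<close>

lemma division_subring_real_frac_vimage:
  assumes "division_subring S"
  shows "division_subring (real_frac -` S)"
  unfolding division_subring_def
  by (auto simp: real_frac_diff real_frac_mult real_frac_inverse intro!: division_subring_intros[OF assms])

text \<open>Every fraction has a denominator with real coefficients: if \<open>m\<close> is a common right multiple of
  \<open>q\<close> and its conjugate, then so is the conjugate of \<open>m\<close>, and one of \<open>m + cnj_skew m\<close> and \<open>m i\<close> is
  nonzero and fixed under conjugation.\<close>

lemma real_right_multiple:
  assumes "q \<noteq> 0"
  obtains s where "q * s \<noteq> 0" "cnj_skew (q * s) = q * s"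
proof -
  have "cnj_skew q \<noteq> 0" using assms by (simp add: cnj_skew.hom_eq_0_iff)
  then obtain s s' where s: "s \<noteq> 0" "s' \<noteq> 0" "q * s = cnj_skew q * s'"
    using common_multiple[OF assms] by blast
  define m where "m = q * s"
  have m: "m \<noteq> 0" unfolding m_def using s(1) assms by simp
  have cnj_m: "cnj_skew m = q * cnj_skew s'"
    unfolding m_def s(3) by (simp add: cnj_skew.hom_mult)
  show thesis
  proof (cases "m + cnj_skew m = 0")
    case False
    moreover have "q * (s + cnj_skew s') = m + cnj_skew m"
      unfolding distrib_left cnj_m by (simp add: m_def)
    moreover have "cnj_skew (m + cnj_skew m) = m + cnj_skew m"
      by (simp add: cnj_skew.hom_add add.commute)
    ultimately show thesis using that[of "s + cnj_skew s'"] by simp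
  next
    case True
    \<comment> \<open>Right multiplication by \<i> cancels this sign against that of its conjugate
      and keeps the left factor \<open>q\<close>.\<close>
    then have "cnj_skew m = - m" by (metis eq_neg_iff_add_eq_0 add.commute)
    moreover have "smonom (- \<i>) 0 = - (smonom \<i> 0 :: CT)" by (simp add: skew_poly_eq_iff)
    ultimately have "cnj_skew (m * smonom \<i> 0) = m * smonom \<i> 0"
      by (simp add: cnj_skew.hom_mult)
    moreover have "smonom \<i> 0 \<noteq> (0 :: CT)" by (auto simp: skew_poly_eq_iff)
    ultimately show thesis
      using that[of "s * smonom \<i> 0"] m by (simp add: m_def flip: mult.assoc)
  qed
qed

text \<open>Over a real denominator, invariance of the fraction is invariance of its numerator,
  which is then real too.\<close>

lemma cnj_frac_fixed:
  assumes "cnj_frac x = x"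
  obtains z where "x = real_frac z"
proof -
  obtain p q where x: "x = RFract p q" "q \<noteq> 0" by (rule RFract_cases)
  obtain s where s: "q * s \<noteq> 0" "cnj_skew (q * s) = q * s"
    using real_right_multiple[OF x(2)] .
  then have "s \<noteq> 0" by auto
  then have x': "x = RFract (p * s) (q * s)" using x RFract_expand by metis
  then have "RFract (cnj_skew (p * s)) (q * s) = RFract (p * s) (q * s)"
    using assms s cnj_frac_RFract by metis
  then have "cnj_skew (p * s) = p * s"
    using RFract_eq_iff_common[OF s(1) s(1), of 1 1] by simp
  then obtain a where a: "p * s = real_skew a" using cnj_skew_fixed by blast
  obtain b where b: "q * s = real_skew b" using cnj_skew_fixed s(2) by blast
  have "b \<noteq> 0" using b s(1) by auto
  then show thesis using that[of "Fract a b"] x' a b by (simp add: real_frac_Fract)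
qed

text \<open>The usual real and imaginary parts. Constants need not commute with \<open>x\<close>, so
  they are kept on the left throughout.\<close>

lemma real_imaginary_decomposition:
  fixes x :: CT_frac
  defines "a \<equiv> CT_const (1 / 2) * (x + cnj_frac x)"
    and "b \<equiv> CT_const (- \<i> / 2) * (x - cnj_frac x)"
  shows "x = a + CT_const \<i> * b" "cnj_frac a = a" "cnj_frac b = b"
proof -
  have "CT_const \<i> * b = CT_const (1 / 2) * (x - cnj_frac x)"
    by (simp add: b_def flip: CT_const_hom mult.assoc)
  then have "a + CT_const \<i> * b = CT_const (1 / 2) * (x + x)"
    unfolding a_def by (simp only: flip: distrib_left) simp
  also have "x + x = CT_const 2 * x"
    using CT_const_hom(3)[of 1 1] by (simp add: CT_const_hom mult_2)
  also have "CT_const (1 / 2) * (CT_const 2 * x) = x"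
    by (simp add: CT_const_hom flip: CT_const_hom(4) mult.assoc)
  finally show "x = a + CT_const \<i> * b" by simp
  show "cnj_frac a = a"
    by (simp add: a_def cnj_frac_mult cnj_frac_add add.commute)
  have "CT_const (\<i> / 2) + CT_const (- \<i> / 2) = 0"
    by (simp add: CT_const_hom flip: CT_const_hom(3))
  then have "CT_const (\<i> / 2) = - CT_const (- \<i> / 2)" by (rule eq_neg_iff_add_eq_0[THEN iffD2])
  then show "cnj_frac b = b"
    by (simp add: b_def cnj_frac_mult cnj_frac_diff right_diff_distrib)
qed

section \<open>Descent to the real subfield and reassembly over \<complex>\<close>

theorem theorem4p4:
  fixes L :: "CT_frac set"
  assumes "division_subring L"
    and "range CT_const \<subseteq> L"
    and "sigma_invariant (phi_frac ` L)"
  shows "\<exists>v :: CT_frac. L = CT_generated v"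
proof -
  note L = assms(1)
  have const: "CT_const c \<in> L" for c using assms(2) by blast
  have cnj_L: "cnj_frac x \<in> L" if "x \<in> L" for x
  proof -
    \<comment> \<open>This element is the image of \<open>phi_frac x\<close> under
      \<open>sigma_frac\<close>; injectivity of \<open>phi_frac\<close> then returns to
      \<open>L\<close>.\<close>
    have "phi_frac (cnj_frac x) \<in> phi_frac ` L"
      using assms(3) that unfolding sigma_invariant_def sigma_frac_phi_frac[symmetric] by blast
    then show ?thesis
      by (simp add: inj_image_mem_iff phi_frac_def phi_poly.inj_rfract_extend)
  qed
  have "range fract_const \<subseteq> real_frac -` L"
    using const by (auto simp: real_frac_const)
  then obtain v where v: "real_frac -` L = division_subring hull (insert v (range fract_const))"
    using Luroth[OF division_subring_real_frac_vimage[OF L]] by blast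
  have "L = CT_generated (real_frac v)"
  proof
    have "v \<in> real_frac -` L"
      unfolding v using hull_subset[of "insert v (range fract_const)" division_subring] by blast
    then show "CT_generated (real_frac v) \<subseteq> L"
      unfolding CT_generated_def by (intro hull_minimal) (use assms(2) L in auto)
  next
    define S where "S = CT_generated (real_frac v)"
    have S: "division_subring S"
      unfolding S_def CT_generated_def by (rule division_subring_hull)
    have S_gen: "real_frac v \<in> S" "CT_const c \<in> S" for c
      using hull_subset[of "insert (real_frac v) (range CT_const)" division_subring]
      by (auto simp: S_def CT_generated_def)
    \<comment> \<open>The generators of the left side map into \<open>S\<close>, so fixed elements
      of \<open>L\<close> lie in \<open>S\<close>.\<close>
    have "real_frac -` L \<subseteq> real_frac -` S"
      unfolding v
      by (intro hull_minimal division_subring_real_frac_vimage S) (auto simp: S_gen real_frac_const)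
    then have fixed: "x \<in> S" if "x \<in> L" "cnj_frac x = x" for x
      using that cnj_frac_fixed by (metis subset_vimage_iff vimageI vimageE subsetD)
    show "L \<subseteq> CT_generated (real_frac v)"
    proof
      fix x assume x: "x \<in> L"
      define a b where "a = CT_const (1 / 2) * (x + cnj_frac x)"
        and "b = CT_const (- \<i> / 2) * (x - cnj_frac x)"
      \<comment> \<open>rests on\<close>
      have "a \<in> L" "b \<in> L"
        using x cnj_L const by (auto simp: a_def b_def intro!: division_subring_intros[OF L])
      then have "a \<in> S" "b \<in> S"
        using fixed real_imaginary_decomposition(2,3)[of x] by (auto simp: a_def b_def)
      then have "a + CT_const \<i> * b \<in> S" by (intro division_subring_intros[OF S] S_gen)
      then show "x \<in> CT_generated (real_frac v)"
        using real_imaginary_decomposition(1)[of x] by (simp add: S_def a_def b_def)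
    qed
  qed
  then show ?thesis ..
qed

end
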